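(* Let $X$ be a Brownian motion with values in $\mathbb{R}^d$, with transition probability density $p_t(x,y)$, and let $C_T\ge 1$ be a constant for which $$|\partial_tp_t(x,y)|\le C_T\,t^{-1}q_{t,x}(y),\qquad t\le T,$$ where $q_{t,x}(y)=c_1t^{-d/2}\exp\big(-c_2t^{-1}|x-y|^2\big)$ with some positive constants $c_1,c_2$ and, for any fixed $t$ and $x$, $q_{t,x}$ is a distribution density. Then for any bounded measurable functions $f,h$ and any real positive number $\lambda$, for $t\le T$, $$\big|R^h_tf(x)-R^h_{t,n}f(x)\big|\le C_{T,\lambda,h}\left(\frac{\log n}{n}\right)\|f\|,$$ where $$C_{T,\lambda,h}=6C_T\,\lambda\|h\|T\,\big(1+\lambda\|h\|T\big)\exp\{\lambda\|h\|T\}.$$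
   Context: $E_x$ denotes expectation for the process conditioned by $X_0=x$. The integral functional and its integral sums are $$I_t(h)=\int_0^t h(X_s)\,ds,\qquad I_{t,n}(h)=\frac{t}{n}\sum_{j=0}^{n-1}h(X_{jt/n}),\quad n\ge1,$$ and $$R^h_tf(x)=E_x\big[f(X_t)\exp\{\lambda I_t(h)\}\big],\qquad R^h_{t,n}f(x)=E_x\big[f(X_t)\exp\{\lambda I_{t,n}(h)\}\big].$$ The family $R^h_t$ is the Feynman--Kac semigroup, with generator $\frac12\Delta f+\lambda hf$. $\|\cdot\|$ is the sup-norm and $|\cdot|$ the Euclidean norm. For Brownian motion the stated bound on $\partial_tp_t$ holds for suitable constants.
   Formalization: The bound is stated for n ≥ 2 instead of n ≥ 1: at n = 1 the right side is 0 because log 1 = 0, while for f = 1 and h the indicator of the complement of {x} the left side is exp(λt) − 1 > 0 when t > 0. *)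

theory Defs
  imports "HOL-Probability.Probability"
begin

definition sup_norm :: "('a \<Rightarrow> real) \<Rightarrow> real" where
  "sup_norm f = (SUP x. \<bar>f x\<bar>)"

text \<open>For \<open>t > 0\<close>, the density at \<open>y\<close> of the normal law with mean \<open>x\<close> and covariance matrix \<open>t I\<close>
  with respect to Lebesgue measure, so that the generator of the process below is half the Laplacian.\<close>

definition transition_density :: "real \<Rightarrow> 'a::euclidean_space \<Rightarrow> 'a \<Rightarrow> real" where
  "transition_density t x y =
     (2 * pi * t) powr (- real DIM('a) / 2) * exp (- (norm (x - y))\<^sup>2 / (2 * t))"

definition gauss_kernel :: "real \<Rightarrow> real \<Rightarrow> real \<Rightarrow> 'a::euclidean_space \<Rightarrow> 'a \<Rightarrow> real" where
  "gauss_kernel c1 c2 t x y =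
     c1 * t powr (- real DIM('a) / 2) * exp (- c2 * (norm (x - y))\<^sup>2 / t)"

text \<open>\<open>P x\<close> is the law of the process started at \<open>x\<close>; the expectation \<open>E\<^sub>x\<close> is the integral against
  \<open>P x\<close>. Time is restricted to \<open>t \<ge> 0\<close>; the values of \<open>X\<close> at negative times are irrelevant. Paths
  are continuous everywhere, not only almost surely, because the measures \<open>P x\<close> need not be complete
  and the time integral of \<open>h (X s)\<close> has to be a measurable function on the sample space.\<close>

locale brownian_motion =
  fixes P :: "'a::euclidean_space \<Rightarrow> 'w measure"
    and X :: "real \<Rightarrow> 'w \<Rightarrow> 'a"
  assumes prob_space_P: "\<And>x. prob_space (P x)"
    and sets_P: "\<And>x y. sets (P x) = sets (P y)"
    and measurable_X: "\<And>x t. 0 \<le> t \<Longrightarrow> X t \<in> borel_measurable (P x)"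
    and start: "\<And>x. AE \<omega> in P x. X 0 \<omega> = x"
    and continuous_paths: "\<And>x \<omega>. \<omega> \<in> space (P x) \<Longrightarrow> continuous_on {0..} (\<lambda>t. X t \<omega>)"
    and gaussian_increments: "\<And>x s t. 0 \<le> s \<Longrightarrow> s < t \<Longrightarrow>
      distributed (P x) lborel (\<lambda>\<omega>. X t \<omega> - X s \<omega>) (\<lambda>z. ennreal (transition_density (t - s) 0 z))"
    and independent_increments: "\<And>x k (\<tau> :: nat \<Rightarrow> real).
      0 \<le> \<tau> 0 \<Longrightarrow> (\<And>i. i < k \<Longrightarrow> \<tau> i \<le> \<tau> (Suc i)) \<Longrightarrow>
      prob_space.indep_vars (P x) (\<lambda>_. borel) (\<lambda>i \<omega>. X (\<tau> (Suc i)) \<omega> - X (\<tau> i) \<omega>) {..<k}"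

definition integral_functional ::
    "(real \<Rightarrow> 'w \<Rightarrow> 'a) \<Rightarrow> real \<Rightarrow> ('a \<Rightarrow> real) \<Rightarrow> 'w \<Rightarrow> real" where
  "integral_functional X t h \<omega> = (LBINT s:{0..t}. h (X s \<omega>))"

definition integral_sum ::
    "(real \<Rightarrow> 'w \<Rightarrow> 'a) \<Rightarrow> real \<Rightarrow> nat \<Rightarrow> ('a \<Rightarrow> real) \<Rightarrow> 'w \<Rightarrow> real" where
  "integral_sum X t n h \<omega> = t / real n * (\<Sum>j<n. h (X (real j * t / real n) \<omega>))"

definition feynman_kac ::
    "('a \<Rightarrow> 'w measure) \<Rightarrow> (real \<Rightarrow> 'w \<Rightarrow> 'a) \<Rightarrow> real \<Rightarrow> ('a \<Rightarrow> real) \<Rightarrow> real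
      \<Rightarrow> ('a \<Rightarrow> real) \<Rightarrow> 'a \<Rightarrow> real" where
  "feynman_kac P X lam h t f x =
     (LINT \<omega>|P x. f (X t \<omega>) * exp (lam * integral_functional X t h \<omega>))"

definition feynman_kac_approx ::
    "('a \<Rightarrow> 'w measure) \<Rightarrow> (real \<Rightarrow> 'w \<Rightarrow> 'a) \<Rightarrow> real \<Rightarrow> ('a \<Rightarrow> real) \<Rightarrow> real \<Rightarrow> nat
      \<Rightarrow> ('a \<Rightarrow> real) \<Rightarrow> 'a \<Rightarrow> real" where
  "feynman_kac_approx P X lam h t n f x =
     (LINT \<omega>|P x. f (X t \<omega>) * exp (lam * integral_sum X t n h \<omega>))"

end

theory Submission imports Defs begin

text \<open>Put \<open>d = t / n\<close> and switch from \<open>exp (lam I\<^sub>t)\<close> to \<open>exp (lam I\<^sub>t\<^sub>,\<^sub>n)\<close> one cell of the grid at a time.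
  Up to an error of order \<open>d\<^sup>2\<close>, the \<open>j\<close>-th step costs the integral over \<open>q\<close> in the cell of
  \<open>E [A (h (X\<^sub>q) - h (X\<^sub>j\<^sub>d)) B]\<close>, where \<open>A\<close> depends on the past of the cell and \<open>B\<close> on its future.
  The bound on the time derivative of the kernel says that moving the time of evaluation from \<open>r\<close> to
  \<open>s\<close> costs at most \<open>C (s - r) / r\<close> in total variation. To use it at distances longer than one cell,
  \<open>A\<close> is telescoped into \<open>1\<close> plus increments of size \<open>O(d)\<close>, each measurable at an earlier grid
  time, and \<open>E [B | X]\<close> into heat flows of functions of size \<open>O(d)\<close> from later grid times. Each cell
  then contributes \<open>d\<close> times (the reciprocals of its distances to both ends, in cells, plus \<open>d\<close> times a
  harmonic sum), which adds up to \<open>log n / n\<close>; the first and the last cell are estimated trivially.\<close>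

subsection \<open>Time regularity of the heat kernel\<close>


text \<open>The obstacle is that \<open>h\<close> is only bounded and measurable: along a single
  path \<open>h (X q)\<close> need not be close to its value at the preceding grid time, however
  small the mesh. Only the law of the process is regular in time, and this regularity degenerates
  like the reciprocal of the elapsed time. Every gain must therefore come from an expectation taken
  across a long stretch of time before or after the cell. The weights on both sides prevent this at
  first sight: the past weight contains a sample one cell earlier, the future weight starts to act
  at the end of the cell. Using the kernel bound at these distances would gain a mere constant in
  each of \<open>n\<close> cells of length \<open>d\<close>, an error of order 1 in total.
  Telescoping pays with extra factors of order \<open>d\<close> for access to longer distances.

  The factor 6 comes from \<open>4 + 2 * harm (n - 2) \<le> 6 * ln n\<close>: each end cell
  contributes 2, and each side of the inner cells one harmonic sum. The hypothesis
  \<open>1 \<le> C\<close> absorbs the terms that do not carry \<open>C\<close>.\<close>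

lemma transition_density_nonneg: "0 \<le> transition_density s x y"
  by (simp add: transition_density_def)

lemma transition_density_measurable [measurable]:
  "transition_density s x \<in> borel_measurable borel"
  unfolding transition_density_def by measurable

lemma transition_density_differentiable:
  assumes "0 < u"
  shows "(\<lambda>u. transition_density u x y) differentiable (at u)"
proof -
  have "((\<lambda>u. 2 * pi * u) has_real_derivative 2 * pi) (at u)"
    by (auto intro!: derivative_eq_intros)
  from DERIV_fun_powr[OF this, of "- real DIM('a) / 2"] assms
  have "(\<lambda>u. (2 * pi * u) powr (- real DIM('a) / 2)) differentiable (at u)"
    using real_differentiable_def by auto
  moreover have "(\<lambda>u. exp (- (norm (x - y))\<^sup>2 / (2 * u))) differentiable (at u)"
  proof -
    have "((\<lambda>u. - (norm (x - y))\<^sup>2 / (2 * u)) has_real_derivative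
        (norm (x - y))\<^sup>2 * 2 / (2 * u * (2 * u))) (at u)"
      using assms by (auto intro!: derivative_eq_intros)
    from DERIV_fun_exp[OF this] show ?thesis
      using real_differentiable_def by blast
  qed
  ultimately show ?thesis
    unfolding transition_density_def by (rule differentiable_mult)
qed

text \<open>Fundamental theorem of calculus in the time variable, in Henstock-Kurzweil form, where
  existence of the derivative suffices. The bound is a nonnegative integral, so that Tonelli applies
  to it without integrability conditions.\<close>

lemma transition_density_diff_le:
  assumes rs: "0 < r" "r \<le> s" "s \<le> T" and c1: "0 \<le> c1" and C: "0 \<le> C"
    and deriv: "\<And>q. 0 < q \<Longrightarrow> q \<le> T \<Longrightarrow>
      \<bar>deriv (\<lambda>u. transition_density u x y) q\<bar> \<le> C * (1 / q) * gauss_kernel c1 c2 q x y"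
  shows "ennreal \<bar>transition_density s x y - transition_density r x y\<bar>
    \<le> (\<integral>\<^sup>+q. ennreal (C * (1 / q) * gauss_kernel c1 c2 q x y) * indicator {r..s} q \<partial>lborel)"
proof -
  let ?p = "\<lambda>u. transition_density u x y"
  let ?K = "\<lambda>q. C * (1 / q) * gauss_kernel c1 c2 q x y"
  have K0: "0 \<le> ?K q" if "q \<in> {r..s}" for q
    using that rs c1 C unfolding gauss_kernel_def by simp
  have "(deriv ?p has_integral (?p s - ?p r)) {r..s}"
  proof (rule fundamental_theorem_of_calculus[OF rs(2)])
    fix u assume "u \<in> {r..s}"
    then have "(?p has_real_derivative deriv ?p u) (at u)"
      using rs transition_density_differentiable[of u x y]
      by (simp add: DERIV_deriv_iff_real_differentiable)
    then show "(?p has_vector_derivative deriv ?p u) (at u within {r..s})"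
      using has_real_derivative_iff_has_vector_derivative has_vector_derivative_at_within by blast
  qed
  then have int: "deriv ?p integrable_on {r..s}" "integral {r..s} (deriv ?p) = ?p s - ?p r"
    by (auto simp: has_integral_integrable_integral)
  have cont: "continuous_on {r..s} ?K"
    unfolding gauss_kernel_def using rs by (intro continuous_intros) auto
  then have si: "set_integrable lborel {r..s} ?K"
    by (rule borel_integrable_atLeastAtMost')
  have "\<bar>?p s - ?p r\<bar> \<le> integral {r..s} ?K"
    using integral_norm_bound_integral[OF int(1) integrable_continuous_interval[OF cont]] deriv rs int(2)
    by auto
  also have "\<dots> = (LBINT q:{r..s}. ?K q)"
    by (rule set_borel_integral_eq_integral(2)[OF si, symmetric])
  finally have "ennreal \<bar>?p s - ?p r\<bar> \<le> ennreal (LBINT q:{r..s}. ?K q)"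
    by (rule ennreal_leI)
  also have "\<dots> = (\<integral>\<^sup>+q. ennreal (indicator {r..s} q *\<^sub>R ?K q) \<partial>lborel)"
    using si K0 unfolding set_lebesgue_integral_def set_integrable_def
    by (intro nn_integral_eq_integral[symmetric]) (auto simp: indicator_def intro!: AE_I2)
  also have "\<dots> = (\<integral>\<^sup>+q. ennreal (?K q) * indicator {r..s} q \<partial>lborel)"
    by (intro nn_integral_cong) (auto simp: indicator_def)
  finally show ?thesis .
qed

lemma gauss_kernel_jointly_measurable:
  "(\<lambda>p. gauss_kernel c1 c2 (fst p) x (snd p)) \<in> borel_measurable (borel \<Otimes>\<^sub>M borel)"
  unfolding gauss_kernel_def by measurable

text \<open>After Tonelli the space integral is innermost, and there the Gaussian kernel has mass 1.
  What remains is the integral of \<open>C / q\<close> over \<open>{r..s}\<close>, estimated with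
  \<open>C / q \<le> C / r\<close>.\<close>

lemma transition_density_L1_diff:
  fixes x :: "'a::euclidean_space"
  assumes rs: "0 < r" "r \<le> s" "s \<le> T" and c1: "0 \<le> c1" and C: "0 \<le> C"
    and prob: "\<And>q. 0 < q \<Longrightarrow>
      prob_space (density lborel (\<lambda>y::'a. ennreal (gauss_kernel c1 c2 q x y)))"
    and deriv: "\<And>q y. 0 < q \<Longrightarrow> q \<le> T \<Longrightarrow>
      \<bar>deriv (\<lambda>u. transition_density u x y) q\<bar> \<le> C * (1 / q) * gauss_kernel c1 c2 q x y"
  shows "(\<integral>\<^sup>+y. ennreal \<bar>transition_density s x y - transition_density r x y\<bar> \<partial>lborel)
    \<le> ennreal (C * ((s - r) / r))"
proof -
  let ?K = "\<lambda>q y. ennreal (C * (1 / q) * gauss_kernel c1 c2 q x y) * indicator {r..s} q"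
  have gm: "(\<lambda>y. gauss_kernel c1 c2 q x y) \<in> borel_measurable borel" for q
    unfolding gauss_kernel_def by measurable
  interpret L: pair_sigma_finite "lborel :: real measure" "lborel :: 'a measure" ..
  have m: "(\<lambda>(q, y). ?K q y) \<in> borel_measurable (lborel \<Otimes>\<^sub>M lborel)"
    using gauss_kernel_jointly_measurable[of c1 c2 x]
    unfolding case_prod_unfold
    by (measurable; simp cong: measurable_cong_sets sets_pair_measure_cong)
  have "(\<integral>\<^sup>+y. ennreal \<bar>transition_density s x y - transition_density r x y\<bar> \<partial>lborel)
      \<le> (\<integral>\<^sup>+y. (\<integral>\<^sup>+q. ?K q y \<partial>lborel) \<partial>lborel)"
    by (intro nn_integral_mono transition_density_diff_le[OF rs c1 C] deriv)
  also have "\<dots> = (\<integral>\<^sup>+q. (\<integral>\<^sup>+y. ?K q y \<partial>lborel) \<partial>lborel)"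
    using lborel_pair.Fubini'[of ?K] m by simp
  also have "\<dots> \<le> (\<integral>\<^sup>+q. ennreal (C / r) * indicator {r..s} q \<partial>lborel)"
  proof (intro nn_integral_mono)
    fix q :: real
    show "(\<integral>\<^sup>+y. ?K q y \<partial>lborel) \<le> ennreal (C / r) * indicator {r..s} q"
    proof (cases "q \<in> {r..s}")
      case True
      then have q: "0 < q" "r \<le> q" using rs by auto
      interpret G: prob_space "density lborel (\<lambda>y::'a. ennreal (gauss_kernel c1 c2 q x y))"
        by (rule prob[OF q(1)])
      have "(\<integral>\<^sup>+y. ennreal (gauss_kernel c1 c2 q x y) \<partial>lborel) = 1"
        using G.emeasure_space_1 gm[of q] by (simp add: emeasure_density)
      moreover have "(\<integral>\<^sup>+y. ?K q y \<partial>lborel)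
          = ennreal (C * (1 / q)) * (\<integral>\<^sup>+y. ennreal (gauss_kernel c1 c2 q x y) \<partial>lborel)"
        using True q C gm[of q] by (subst nn_integral_cmult[symmetric]) (auto simp: ennreal_mult'[symmetric])
      ultimately show ?thesis
        using True q rs C by (simp add: frac_le)
    qed simp
  qed
  also have "\<dots> = ennreal (C / r) * ennreal (s - r)"
    using rs by (simp add: nn_integral_cmult)
  also have "\<dots> = ennreal (C * ((s - r) / r))"
    using rs C by (simp add: ennreal_mult'[symmetric])
  finally show ?thesis .
qed

text \<open>Passes from total variation to test functions. Both expectations become Lebesgue
  integrals of \<open>\<phi>\<close> against densities, so the difference of the densities carries
  all the smallness, with no regularity of \<open>\<phi>\<close> involved.\<close>

lemma (in prob_space) expectation_diff_density:
  fixes U V :: "'a \<Rightarrow> 'b::euclidean_space" and \<phi> :: "'b \<Rightarrow> real"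
  assumes U: "distributed M lborel U (\<lambda>z. ennreal (p z))"
    and V: "distributed M lborel V (\<lambda>z. ennreal (q z))"
    and p: "p \<in> borel_measurable borel" "\<And>z. 0 \<le> p z"
    and q: "q \<in> borel_measurable borel" "\<And>z. 0 \<le> q z"
    and L1: "(\<integral>\<^sup>+z. ennreal \<bar>p z - q z\<bar> \<partial>lborel) \<le> ennreal K" and K: "0 \<le> K"
    and \<phi>: "\<phi> \<in> borel_measurable borel" "\<And>z. \<bar>\<phi> z\<bar> \<le> \<beta>"
  shows "\<bar>expectation (\<lambda>\<omega>. \<phi> (U \<omega>)) - expectation (\<lambda>\<omega>. \<phi> (V \<omega>))\<bar> \<le> \<beta> * K"
proof -
  have \<beta>: "0 \<le> \<beta>" using \<phi>(2)[of 0] by linarith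
  have integrable_mult: "integrable lborel (\<lambda>z. g z * \<phi> z)"
    if d: "distributed M lborel Y (\<lambda>z. ennreal (g z))" and g: "g \<in> borel_measurable borel" "\<And>z. 0 \<le> g z"
    for g :: "'b \<Rightarrow> real" and Y
  proof -
    have "integrable lborel g"
      using distributed_integrable[OF d, of "\<lambda>_. 1 :: real"] g by simp
    then have "integrable lborel (\<lambda>z. g z * \<beta>)" by simp
    then show ?thesis
      using g \<phi> \<beta> by (elim Bochner_Integration.integrable_bound)
        (auto intro!: mult_left_mono simp: abs_mult)
  qed
  have eq: "expectation (\<lambda>\<omega>. \<phi> (U \<omega>)) = (\<integral>z. p z * \<phi> z \<partial>lborel)"
    "expectation (\<lambda>\<omega>. \<phi> (V \<omega>)) = (\<integral>z. q z * \<phi> z \<partial>lborel)"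
    using distributed_integral[OF U, of \<phi>] distributed_integral[OF V, of \<phi>] p q \<phi> by auto
  have "ennreal \<bar>expectation (\<lambda>\<omega>. \<phi> (U \<omega>)) - expectation (\<lambda>\<omega>. \<phi> (V \<omega>))\<bar>
      = ennreal (norm (\<integral>z. (p z - q z) * \<phi> z \<partial>lborel))"
    unfolding eq using integrable_mult[OF U p] integrable_mult[OF V q]
    by (simp add: left_diff_distrib)
  also have "\<dots> \<le> (\<integral>\<^sup>+z. norm ((p z - q z) * \<phi> z) \<partial>lborel)"
    using integrable_mult[OF U p] integrable_mult[OF V q]
    by (intro integral_norm_bound_ennreal) (simp add: left_diff_distrib)
  also have "\<dots> \<le> (\<integral>\<^sup>+z. ennreal \<beta> * ennreal \<bar>p z - q z\<bar> \<partial>lborel)"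
    using \<phi>(2) \<beta>
    by (intro nn_integral_mono)
       (auto simp: abs_mult ennreal_mult'[symmetric] mult.commute intro!: mult_right_mono ennreal_leI)
  also have "\<dots> = ennreal \<beta> * (\<integral>\<^sup>+z. ennreal \<bar>p z - q z\<bar> \<partial>lborel)"
    using p q by (intro nn_integral_cmult) auto
  also have "\<dots> \<le> ennreal (\<beta> * K)"
    using L1 \<beta> by (simp add: ennreal_mult' mult_left_mono)
  finally show ?thesis using \<beta> K by simp
qed


subsection \<open>Independence of past and future\<close>

text \<open>A sigma-algebra encoded as a \<open>measure\<close>, so that being known at a given time
  is an ordinary \<open>measurable\<close> statement.\<close>

definition generated :: "'w set \<Rightarrow> ('i \<Rightarrow> 'w \<Rightarrow> 'b::topological_space) \<Rightarrow> 'i set \<Rightarrow> 'w measure" where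
  "generated \<Omega> Z I = sigma \<Omega> (\<Union>i\<in>I. {Z i -` B \<inter> \<Omega> |B. B \<in> sets borel})"

lemma space_generated [simp]: "space (generated \<Omega> Z I) = \<Omega>"
  unfolding generated_def by (rule space_measure_of) auto

lemma sets_generated:
  "sets (generated \<Omega> Z I) = sigma_sets \<Omega> (\<Union>i\<in>I. {Z i -` B \<inter> \<Omega> |B. B \<in> sets borel})"
  unfolding generated_def by (rule sets_measure_of) auto

lemma measurable_generated:
  assumes "i \<in> I"
  shows "Z i \<in> borel_measurable (generated \<Omega> Z I)"
  using assms by (intro measurableI) (auto simp: sets_generated intro!: sigma_sets.Basic)

lemma sets_generated_le:
  assumes "\<Omega> = space N" "\<And>i. i \<in> I \<Longrightarrow> Z i \<in> borel_measurable N"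
  shows "sets (generated \<Omega> Z I) \<subseteq> sets N"
  unfolding sets_generated assms(1)
  by (intro sets.sigma_sets_subset) (auto intro: measurable_sets[OF assms(2)])

lemma sets_generated_mono:
  assumes "I \<subseteq> J"
  shows "sets (generated \<Omega> Z I) \<subseteq> sets (generated \<Omega> Z J)"
  using assms by (intro sets_generated_le) (auto intro: measurable_generated)

text \<open>Prepares the pi-lambda argument: the sigma-algebra of a continuum of times is generated
  by events that depend on finitely many times, and these are closed under intersection.\<close>

lemma sets_generated_finite_union:
  "sets (generated \<Omega> Z I) = sigma_sets \<Omega> (\<Union>Q\<in>{Q. finite Q \<and> Q \<subseteq> I}. sets (generated \<Omega> Z Q))"
    (is "_ = sigma_sets \<Omega> ?E")
proof (rule antisym)
  have "Z i -` B \<inter> \<Omega> \<in> ?E" if "i \<in> I" "B \<in> sets borel" for i B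
    using that measurable_sets[OF measurable_generated[of i "{i}" Z \<Omega>], of B]
    by (intro UN_I[of "{i}"]) auto
  then show "sets (generated \<Omega> Z I) \<subseteq> sigma_sets \<Omega> ?E"
    unfolding sets_generated[of \<Omega> Z I] by (intro sigma_sets_mono') blast
  have "?E \<subseteq> sets (generated \<Omega> Z I)"
    using sets_generated_mono by fastforce
  then show "sigma_sets \<Omega> ?E \<subseteq> sets (generated \<Omega> Z I)"
    using sets.sigma_sets_subset[of ?E "generated \<Omega> Z I"] by simp
qed

lemma Int_stable_generated_finite:
  "Int_stable (\<Union>Q\<in>{Q. finite Q \<and> Q \<subseteq> I}. sets (generated \<Omega> Z Q))"
proof (rule Int_stableI)
  fix a b
  assume "a \<in> (\<Union>Q\<in>{Q. finite Q \<and> Q \<subseteq> I}. sets (generated \<Omega> Z Q))"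
     and "b \<in> (\<Union>Q\<in>{Q. finite Q \<and> Q \<subseteq> I}. sets (generated \<Omega> Z Q))"
  then obtain Q R where "finite Q" "Q \<subseteq> I" "a \<in> sets (generated \<Omega> Z Q)"
      "finite R" "R \<subseteq> I" "b \<in> sets (generated \<Omega> Z R)"
    by auto
  then have "finite (Q \<union> R)" "Q \<union> R \<subseteq> I" "a \<inter> b \<in> sets (generated \<Omega> Z (Q \<union> R))"
    using sets_generated_mono[of Q "Q \<union> R" \<Omega> Z] sets_generated_mono[of R "Q \<union> R" \<Omega> Z] by auto
  then show "a \<inter> b \<in> (\<Union>Q\<in>{Q. finite Q \<and> Q \<subseteq> I}. sets (generated \<Omega> Z Q))"
    by blast
qed

lemma measurable_cong_sigma_le:
  assumes "f \<in> measurable N' K" "sets N' \<subseteq> sets N" "space N' = space N"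
  shows "f \<in> measurable N K"
  using assms unfolding measurable_def by auto

text \<open>Time is rounded down to a dyadic number. The rounded process uses countably many times
  and is jointly measurable; continuity of the paths gives convergence at every point.\<close>

lemma borel_measurable_continuous_process:
  fixes Z :: "real \<Rightarrow> 'w \<Rightarrow> 'a::metric_space"
  assumes meas: "\<And>q. Z q \<in> borel_measurable N"
    and cont: "\<And>\<omega>. \<omega> \<in> space N \<Longrightarrow> continuous_on UNIV (\<lambda>q. Z q \<omega>)"
  shows "(\<lambda>p. Z (snd p) (fst p)) \<in> borel_measurable (N \<Otimes>\<^sub>M borel)"
proof (rule borel_measurable_LIMSEQ_metric)
  define g where "g k p = Z (real_of_int \<lfloor>snd p * 2 ^ k\<rfloor> / 2 ^ k) (fst p)"
    for k :: nat and p :: "'w \<times> real"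
  show "g k \<in> borel_measurable (N \<Otimes>\<^sub>M borel)" for k
    unfolding g_def
    by (rule measurable_compose_countable[where f = "\<lambda>i p. Z (real_of_int i / 2 ^ k) (fst p)"
          and g = "\<lambda>p. \<lfloor>snd p * 2 ^ k\<rfloor>"])
       (auto intro!: measurable_compose[OF measurable_fst meas])
  fix p assume p: "p \<in> space (N \<Otimes>\<^sub>M (borel :: real measure))"
  have "(\<lambda>k. real_of_int \<lfloor>snd p * 2 ^ k\<rfloor> / 2 ^ k) \<longlonglongrightarrow> snd p"
  proof (rule tendsto_sandwich[of "\<lambda>k. snd p - (1/2) ^ k" _ _ "\<lambda>_. snd p"])
    show "(\<lambda>k. snd p - (1/2) ^ k) \<longlonglongrightarrow> snd p"
      using tendsto_diff[OF tendsto_const LIMSEQ_power_zero[of "1/2::real"]] by simp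
    have "snd p - (1/2) ^ k \<le> real_of_int \<lfloor>snd p * 2 ^ k\<rfloor> / 2 ^ k" for k :: nat
    proof -
      have "(snd p * 2 ^ k - 1) / 2 ^ k \<le> real_of_int \<lfloor>snd p * 2 ^ k\<rfloor> / 2 ^ k"
        by (intro divide_right_mono) (linarith, simp)
      then show ?thesis by (simp add: diff_divide_distrib power_divide)
    qed
    then show "\<forall>\<^sub>F k in sequentially. snd p - (1/2) ^ k \<le> real_of_int \<lfloor>snd p * 2 ^ k\<rfloor> / 2 ^ k"
      by simp
    show "\<forall>\<^sub>F k in sequentially. real_of_int \<lfloor>snd p * 2 ^ k\<rfloor> / 2 ^ k \<le> snd p"
      by (simp add: field_simps)
  qed simp
  moreover have "isCont (\<lambda>q. Z q (fst p)) (snd p)"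
    using cont[of "fst p"] p by (auto simp: space_pair_measure continuous_on_eq_continuous_at)
  ultimately show "(\<lambda>k. g k p) \<longlonglongrightarrow> Z (snd p) (fst p)"
    unfolding g_def by (rule isCont_tendsto_compose[rotated])
qed

text \<open>What is used of Brownian motion apart from the time regularity of its law.
  \<open>W_0\<close> holds at every sample point, so that sums of increments starting at time 0 are
  values of \<open>W\<close>.\<close>

locale levy_process = prob_space M for M :: "'w measure" +
  fixes W :: "real \<Rightarrow> 'w \<Rightarrow> 'a::euclidean_space"
  assumes W_measurable: "0 \<le> q \<Longrightarrow> W q \<in> borel_measurable M"
    and W_continuous: "\<omega> \<in> space M \<Longrightarrow> continuous_on {0..} (\<lambda>q. W q \<omega>)"
    and W_0: "W 0 \<omega> = 0"
    and W_stationary: "0 \<le> s \<Longrightarrow> s \<le> t \<Longrightarrow>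
      distr M borel (\<lambda>\<omega>. W t \<omega> - W s \<omega>) = distr M borel (W (t - s))"
    and W_independent: "\<And>k (\<tau> :: nat \<Rightarrow> real).
      0 \<le> \<tau> 0 \<Longrightarrow> (\<And>i. i < k \<Longrightarrow> \<tau> i \<le> \<tau> (Suc i)) \<Longrightarrow>
      indep_vars (\<lambda>_. borel) (\<lambda>i \<omega>. W (\<tau> (Suc i)) \<omega> - W (\<tau> i) \<omega>) {..<k}"
begin

definition past :: "real \<Rightarrow> 'w measure" where
  "past v = generated (space M) W {0..v}"

text \<open>Built from increments after \<open>v\<close> instead of values, because the values
  themselves still depend on the past through \<open>W v\<close>.\<close>

definition future :: "real \<Rightarrow> 'w measure" where
  "future v = generated (space M) (\<lambda>q \<omega>. W q \<omega> - W v \<omega>) {v..}"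

lemma space_past [simp]: "space (past v) = space M"
  by (simp add: past_def)

lemma space_future [simp]: "space (future v) = space M"
  by (simp add: future_def)

lemma sets_past_le: "sets (past v) \<subseteq> sets M"
  unfolding past_def by (intro sets_generated_le) (auto intro: W_measurable)

lemma sets_future_le: "0 \<le> v \<Longrightarrow> sets (future v) \<subseteq> sets M"
  unfolding future_def
  by (intro sets_generated_le) (auto intro!: borel_measurable_diff W_measurable)

lemma W_past: "0 \<le> q \<Longrightarrow> q \<le> v \<Longrightarrow> W q \<in> borel_measurable (past v)"
  unfolding past_def by (intro measurable_generated) auto

lemma W_future: "v \<le> q \<Longrightarrow> (\<lambda>\<omega>. W q \<omega> - W v \<omega>) \<in> borel_measurable (future v)"
  unfolding future_def by (rule measurable_generated[of _ _ "\<lambda>q \<omega>. W q \<omega> - W v \<omega>"]) auto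

lemma measurable_past_le: "f \<in> measurable (past v) K \<Longrightarrow> f \<in> measurable M K"
  by (rule measurable_cong_sigma_le[OF _ sets_past_le]) auto

lemma measurable_future_le: "0 \<le> v \<Longrightarrow> f \<in> measurable (future v) K \<Longrightarrow> f \<in> measurable M K"
  by (rule measurable_cong_sigma_le[OF _ sets_future_le]) auto

text \<open>Partial sums are functions of the vector of increments, so their sigma-algebra lies
  below that of the vector. In this form independence of two blocks of increments passes to the
  process itself.\<close>

lemma increments_generate:
  fixes D :: "nat \<Rightarrow> 'w \<Rightarrow> 'a"
  assumes "\<And>q. q \<in> Q \<Longrightarrow> \<exists>J\<subseteq>S. \<forall>\<omega>\<in>space M. Z q \<omega> = (\<Sum>i\<in>J. D i \<omega>)"
    and S: "finite S"
    and D: "\<And>i. i \<in> S \<Longrightarrow> D i \<in> borel_measurable M"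
  shows "sets (generated (space M) Z Q) \<subseteq> sigma_sets (space M)
    {(\<lambda>\<omega>. restrict (\<lambda>i. D i \<omega>) S) -` A \<inter> space M | A. A \<in> sets (PiM S (\<lambda>_. borel))}"
proof -
  let ?N = "vimage_algebra (space M) (\<lambda>\<omega>. restrict (\<lambda>i. D i \<omega>) S) (PiM S (\<lambda>_. borel :: 'a measure))"
  have sp: "(\<lambda>\<omega>. restrict (\<lambda>i. D i \<omega>) S) \<in> space M \<rightarrow> space (PiM S (\<lambda>_. borel :: 'a measure))"
    by (auto simp: space_PiM)
  have meas: "(\<lambda>\<omega>. restrict (\<lambda>i. D i \<omega>) S) \<in> measurable ?N (PiM S (\<lambda>_. borel :: 'a measure))"
    by (rule measurable_vimage_algebra1[OF sp])
  have "Z q \<in> borel_measurable ?N" if q: "q \<in> Q" for q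
  proof -
    obtain J where J: "J \<subseteq> S" "\<forall>\<omega>\<in>space M. Z q \<omega> = (\<Sum>i\<in>J. D i \<omega>)"
      using assms(1)[OF q] by blast
    have "(\<lambda>g. \<Sum>i\<in>J. g i) \<in> borel_measurable (PiM S (\<lambda>_. borel :: 'a measure))"
      using J(1) by (intro borel_measurable_sum measurable_component_singleton) auto
    from measurable_compose[OF meas this]
    have "(\<lambda>\<omega>. \<Sum>i\<in>J. restrict (\<lambda>i. D i \<omega>) S i) \<in> borel_measurable ?N" .
    then show ?thesis
      by (rule measurable_cong[THEN iffD2, rotated])
         (use J in \<open>auto intro!: sum.cong\<close>)
  qed
  then have "sets (generated (space M) Z Q) \<subseteq> sets ?N"
    by (intro sets_generated_le) auto
  then show ?thesis
    using sets_vimage_algebra2[OF sp] by (auto intro!: sigma_sets.Basic)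
qed

text \<open>Independence is given for increments along one monotone sequence. All times are arranged
  in such a sequence, and its increments are split into two blocks at \<open>v\<close>.\<close>

lemma indep_past_future_finite:
  assumes v: "0 \<le> v" and Q: "finite Q" "Q \<subseteq> {0..v}" and R: "finite R" "R \<subseteq> {v..}"
  shows "indep_set (sets (generated (space M) W Q))
    (sets (generated (space M) (\<lambda>q \<omega>. W q \<omega> - W v \<omega>) R))"
proof -
  \<comment> \<open>\<open>v\<close> is an entry of both lists: it closes the first and opens the
    second. Hence index \<open>K\<close> starts a block of increments from \<open>v\<close>, and the
    increment between the two copies of \<open>v\<close> is zero and falls harmlessly into the first
    block.\<close>
  define l1 where "l1 = sorted_list_of_set (insert 0 (insert v Q))"
  define l2 where "l2 = sorted_list_of_set (insert v R)"
  define l where "l = l1 @ l2"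
  define K where "K = length l1"
  define k where "k = length l - 1"
  define \<tau> where "\<tau> i = l ! i" for i
  define D where "D i \<omega> = W (\<tau> (Suc i)) \<omega> - W (\<tau> i) \<omega>" for i \<omega>
  have s1: "set l1 = insert 0 (insert v Q)" "sorted l1" and s2: "set l2 = insert v R" "sorted l2"
    using Q(1) R(1) unfolding l1_def l2_def
    by (simp_all only: set_sorted_list_of_set finite_insert sorted_sorted_list_of_set)
  have sl: "sorted l"
  proof -
    have "x \<le> y" if "x \<in> insert 0 (insert v Q)" "y \<in> insert v R" for x y
    proof -
      have "x \<le> v" "v \<le> y" using that Q R v by auto
      then show ?thesis by simp
    qed
    then show ?thesis using s1 s2 unfolding l_def sorted_append by blast
  qed
  have "0 < length l1" "0 < length l2"
    using s1(1) s2(1) by (metis insert_not_empty length_greater_0_conv set_empty)+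
  then have ne: "0 < length l1" "0 < length l2" and K: "0 < K" "K \<le> k" "Suc k = length l"
    unfolding K_def k_def l_def length_append by linarith+
  have mono: "\<tau> i \<le> \<tau> j" if "i \<le> j" "j \<le> k" for i j
    unfolding \<tau>_def using that K by (intro sorted_nth_mono[OF sl]) auto
  have \<tau>1: "\<tau> i = l1 ! i" if "i < K" for i
    using that by (simp add: \<tau>_def l_def K_def nth_append)
  have \<tau>2: "\<tau> (K + i) = l2 ! i" for i
    by (simp add: \<tau>_def l_def K_def)
  have in1: "\<exists>i<K. \<tau> i = q" if q: "q \<in> insert 0 (insert v Q)" for q
  proof -
    obtain m where "m < length l1" "l1 ! m = q"
      using q s1(1) by (metis in_set_conv_nth)
    then show ?thesis using \<tau>1 K_def by auto
  qed
  have in2: "\<exists>i. K \<le> i \<and> i \<le> k \<and> \<tau> i = q" if q: "q \<in> insert v R" for q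
  proof -
    obtain m where "m < length l2" "l2 ! m = q"
      using q s2(1) by (metis in_set_conv_nth)
    then show ?thesis using \<tau>2[of m]
      by (intro exI[of _ "K + m"]) (auto simp: K_def k_def l_def)
  qed
  have \<tau>0: "\<tau> 0 = 0"
  proof -
    have "\<tau> 0 \<in> set l1" using \<tau>1[of 0] K(1) K_def by simp
    then have "0 \<le> \<tau> 0" using s1 Q v by auto
    moreover obtain i where "i < K" "\<tau> i = 0" using in1[of 0] by auto
    ultimately show ?thesis using mono[of 0 i] K by auto
  qed
  have \<tau>K: "\<tau> K = v"
  proof -
    have "\<tau> K \<in> set l2" using \<tau>2[of 0] ne by simp
    then have "v \<le> \<tau> K" using s2 R by auto
    moreover obtain i where "K \<le> i" "i \<le> k" "\<tau> i = v" using in2[of v] by auto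
    ultimately show ?thesis using mono[of K i] by auto
  qed
  have tele: "(\<Sum>m\<in>{i..<j}. D m \<omega>) = W (\<tau> j) \<omega> - W (\<tau> i) \<omega>" if "i \<le> j" for i j \<omega>
    unfolding D_def using that by (rule sum_Suc_diff')
  have nonneg: "0 \<le> \<tau> i" if "i \<le> k" for i using mono[of 0 i] that \<tau>0 by simp
  have Dm: "D i \<in> borel_measurable M" if "i < k" for i
    unfolding D_def using that nonneg by (intro borel_measurable_diff W_measurable) auto
  have iv: "indep_vars (\<lambda>_. borel) D {..<k}"
    unfolding D_def by (rule W_independent) (use \<tau>0 mono in auto)
  have "indep_var (PiM {..<K} (\<lambda>_. borel)) (\<lambda>\<omega>. restrict (\<lambda>i. D i \<omega>) {..<K})
      (PiM {K..<k} (\<lambda>_. borel)) (\<lambda>\<omega>. restrict (\<lambda>i. D i \<omega>) {K..<k})"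
    using K by (intro indep_var_restrict[OF iv]) auto
  then have ind: "indep_set
      (sigma_sets (space M) {(\<lambda>\<omega>. restrict (\<lambda>i. D i \<omega>) {..<K}) -` A \<inter> space M |A.
        A \<in> sets (PiM {..<K} (\<lambda>_. borel))})
      (sigma_sets (space M) {(\<lambda>\<omega>. restrict (\<lambda>i. D i \<omega>) {K..<k}) -` A \<inter> space M |A.
        A \<in> sets (PiM {K..<k} (\<lambda>_. borel))})"
    unfolding indep_var_eq by simp
  have "sets (generated (space M) W Q) \<subseteq> sigma_sets (space M)
      {(\<lambda>\<omega>. restrict (\<lambda>i. D i \<omega>) {..<K}) -` A \<inter> space M | A. A \<in> sets (PiM {..<K} (\<lambda>_. borel))}"
  proof (rule increments_generate)
    fix q assume "q \<in> Q"
    then obtain i where "i < K" "\<tau> i = q" using in1[of q] by auto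
    then show "\<exists>J\<subseteq>{..<K}. \<forall>\<omega>\<in>space M. W q \<omega> = (\<Sum>i\<in>J. D i \<omega>)"
      by (intro exI[of _ "{0..<i}"]) (auto simp: tele \<tau>0 W_0)
  qed (use Dm K in auto)
  moreover have "sets (generated (space M) (\<lambda>q \<omega>. W q \<omega> - W v \<omega>) R) \<subseteq> sigma_sets (space M)
      {(\<lambda>\<omega>. restrict (\<lambda>i. D i \<omega>) {K..<k}) -` A \<inter> space M | A. A \<in> sets (PiM {K..<k} (\<lambda>_. borel))}"
  proof (rule increments_generate)
    fix q assume "q \<in> R"
    then obtain i where "K \<le> i" "i \<le> k" "\<tau> i = q" using in2[of q] by auto
    then show "\<exists>J\<subseteq>{K..<k}. \<forall>\<omega>\<in>space M. W q \<omega> - W v \<omega> = (\<Sum>i\<in>J. D i \<omega>)"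
      by (intro exI[of _ "{K..<i}"]) (auto simp: tele \<tau>K)
  qed (use Dm K in auto)
  ultimately show ?thesis
    using ind unfolding indep_sets2_eq by blast
qed

lemma indep_past_future:
  assumes v: "0 \<le> v"
  shows "indep_set (sets (past v)) (sets (future v))"
  unfolding past_def future_def sets_generated_finite_union[of _ _ "{0..v}"]
    sets_generated_finite_union[of _ _ "{v..}"]
proof (rule indep_set_sigma_sets)
  show "indep_set (\<Union>Q\<in>{Q. finite Q \<and> Q \<subseteq> {0..v}}. sets (generated (space M) W Q))
     (\<Union>Q\<in>{Q. finite Q \<and> Q \<subseteq> {v..}}. sets (generated (space M) (\<lambda>q \<omega>. W q \<omega> - W v \<omega>) Q))"
    (is "indep_set ?A ?B")
  proof (rule indep_setI)
    show "?A \<subseteq> events"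
      using sets_generated_mono[of _ "{0..v}" "space M" W] sets_past_le[of v]
      unfolding past_def by blast
    show "?B \<subseteq> events"
      using sets_generated_mono[of _ "{v..}" "space M" "\<lambda>q \<omega>. W q \<omega> - W v \<omega>"] sets_future_le[OF v]
      unfolding future_def by blast
    fix a b assume "a \<in> ?A" "b \<in> ?B"
    then obtain Q R where "finite Q" "Q \<subseteq> {0..v}" "a \<in> sets (generated (space M) W Q)"
      "finite R" "R \<subseteq> {v..}" "b \<in> sets (generated (space M) (\<lambda>q \<omega>. W q \<omega> - W v \<omega>) R)"
      by auto
    then show "prob (a \<inter> b) = prob a * prob b"
      using indep_past_future_finite[OF v, of Q R] unfolding indep_sets2_eq by blast
  qed
qed (rule Int_stable_generated_finite)+

text \<open>The simple Markov property without conditional expectations: whatever is known at time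
  \<open>v\<close> is frozen while the future is averaged. The random point \<open>\<xi>\<close>
  enters \<open>G\<close> as a parameter, which is why \<open>G\<close> has two arguments.\<close>

lemma markov:
  fixes Z :: "'w \<Rightarrow> real" and \<xi> :: "'w \<Rightarrow> 'a" and G :: "'a \<Rightarrow> 'w \<Rightarrow> real"
  assumes v: "0 \<le> v"
    and Z: "Z \<in> borel_measurable (past v)" "\<And>\<omega>. \<omega> \<in> space M \<Longrightarrow> \<bar>Z \<omega>\<bar> \<le> c"
    and \<xi>: "\<xi> \<in> borel_measurable (past v)"
    and G: "case_prod G \<in> borel_measurable (borel \<Otimes>\<^sub>M future v)"
      "\<And>y \<omega>. \<omega> \<in> space M \<Longrightarrow> \<bar>G y \<omega>\<bar> \<le> d"
  shows "(\<integral>\<omega>. Z \<omega> * G (\<xi> \<omega>) \<omega> \<partial>M) = (\<integral>\<omega>. Z \<omega> * (\<integral>\<omega>'. G (\<xi> \<omega>) \<omega>' \<partial>M) \<partial>M)"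
proof -
  have idp: "(\<lambda>\<omega>. \<omega>) \<in> measurable M (past v)" and idf: "(\<lambda>\<omega>. \<omega>) \<in> measurable M (future v)"
    using measurable_past_le[OF measurable_ident] measurable_future_le[OF v measurable_ident]
    by (auto simp: id_def)
  interpret A: prob_space "distr M (past v) (\<lambda>\<omega>. \<omega>)" by (rule prob_space_distr[OF idp])
  interpret B: prob_space "distr M (future v) (\<lambda>\<omega>. \<omega>)" by (rule prob_space_distr[OF idf])
  interpret AB: pair_prob_space "distr M (past v) (\<lambda>\<omega>. \<omega>)" "distr M (future v) (\<lambda>\<omega>. \<omega>)" ..
  have ps: "{(\<lambda>\<omega>. \<omega>) -` A \<inter> space M |A. A \<in> sets (past v)} = sets (past v)"
     and fs: "{(\<lambda>\<omega>. \<omega>) -` A \<inter> space M |A. A \<in> sets (future v)} = sets (future v)"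
    using sets.sets_into_space[of _ "past v"] sets.sets_into_space[of _ "future v"]
    by (auto simp: Int_absorb2)
  have "sigma_sets (space M) (sets (past v)) = sets (past v)"
     and "sigma_sets (space M) (sets (future v)) = sets (future v)"
    using sets.sigma_sets_eq[of "past v"] sets.sigma_sets_eq[of "future v"] by auto
  \<comment> \<open>The identity map, read once into \<open>past v\<close> and once into
    \<open>future v\<close>, gives two independent random elements. The law of the diagonal map is
    therefore a product measure, and Fubini can average over the future alone.\<close>
  then have "indep_var (past v) (\<lambda>\<omega>. \<omega>) (future v) (\<lambda>\<omega>. \<omega>)"
    unfolding indep_var_eq ps fs using indep_past_future[OF v] idp idf by simp
  then have joint: "distr M (past v) (\<lambda>\<omega>. \<omega>) \<Otimes>\<^sub>M distr M (future v) (\<lambda>\<omega>. \<omega>)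
      = distr M (past v \<Otimes>\<^sub>M future v) (\<lambda>\<omega>. (\<omega>, \<omega>))"
    unfolding indep_var_distribution_eq by simp
  have "(\<lambda>p. (\<xi> (fst p), snd p)) \<in> measurable (past v \<Otimes>\<^sub>M future v) (borel \<Otimes>\<^sub>M future v)"
    using \<xi> by measurable
  from measurable_compose[OF this G(1)]
  have Gm: "(\<lambda>p. G (\<xi> (fst p)) (snd p)) \<in> borel_measurable (past v \<Otimes>\<^sub>M future v)" by simp
  have Zm: "(\<lambda>p. Z (fst p)) \<in> borel_measurable (past v \<Otimes>\<^sub>M future v)"
    using Z(1) by measurable
  have F: "(\<lambda>p. Z (fst p) * G (\<xi> (fst p)) (snd p)) \<in> borel_measurable (past v \<Otimes>\<^sub>M future v)"
    using Zm Gm by measurable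
  have bd: "\<bar>Z \<omega> * G (\<xi> \<omega>) \<omega>'\<bar> \<le> c * d" if "\<omega> \<in> space M" "\<omega>' \<in> space M" for \<omega> \<omega>'
    using Z(2)[OF that(1)] G(2)[OF that(2), of "\<xi> \<omega>"] unfolding abs_mult by (intro mult_mono) auto
  have "(\<integral>\<omega>. Z \<omega> * G (\<xi> \<omega>) \<omega> \<partial>M)
      = (\<integral>p. Z (fst p) * G (\<xi> (fst p)) (snd p) \<partial>distr M (past v \<Otimes>\<^sub>M future v) (\<lambda>\<omega>. (\<omega>, \<omega>)))"
    using F idp idf by (subst integral_distr) auto
  also have "\<dots> = (\<integral>p. (case p of (a, b) \<Rightarrow> Z a * G (\<xi> a) b)
      \<partial>(distr M (past v) (\<lambda>\<omega>. \<omega>) \<Otimes>\<^sub>M distr M (future v) (\<lambda>\<omega>. \<omega>)))"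
    unfolding joint by (simp add: case_prod_unfold)
  also have "\<dots> = (\<integral>a. (\<integral>b. Z a * G (\<xi> a) b \<partial>distr M (future v) (\<lambda>\<omega>. \<omega>))
      \<partial>distr M (past v) (\<lambda>\<omega>. \<omega>))"
  proof (rule AB.integral_fst[symmetric])
    show "integrable (distr M (past v) (\<lambda>\<omega>. \<omega>) \<Otimes>\<^sub>M distr M (future v) (\<lambda>\<omega>. \<omega>))
        (\<lambda>(a, b). Z a * G (\<xi> a) b)"
      using F bd
      by (intro AB.P.integrable_const_bound[of _ "c * d"])
         (auto simp: case_prod_unfold space_pair_measure intro!: AE_I2 cong: measurable_cong_sets)
  qed
  also have "\<dots> = (\<integral>a. Z a * (\<integral>b. G (\<xi> a) b \<partial>distr M (future v) (\<lambda>\<omega>. \<omega>))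
      \<partial>distr M (past v) (\<lambda>\<omega>. \<omega>))"
    by simp
  also have "\<dots> = (\<integral>\<omega>. Z \<omega> * (\<integral>b. G (\<xi> \<omega>) b \<partial>distr M (future v) (\<lambda>\<omega>. \<omega>)) \<partial>M)"
  proof (rule integral_distr[OF idp])
    have "(\<lambda>a. \<integral>b. G (\<xi> a) b \<partial>distr M (future v) (\<lambda>\<omega>. \<omega>)) \<in> borel_measurable (past v)"
      by (rule B.borel_measurable_lebesgue_integral)
         (use Gm in \<open>simp add: case_prod_unfold cong: measurable_cong_sets\<close>)
    then show "(\<lambda>a. Z a * (\<integral>b. G (\<xi> a) b \<partial>distr M (future v) (\<lambda>\<omega>. \<omega>))) \<in> borel_measurable (past v)"
      using Z(1) by measurable
  qed
  also have "\<dots> = (\<integral>\<omega>. Z \<omega> * (\<integral>\<omega>'. G (\<xi> \<omega>) \<omega>' \<partial>M) \<partial>M)"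
  proof -
    have "(\<integral>b. G y b \<partial>distr M (future v) (\<lambda>\<omega>. \<omega>)) = (\<integral>\<omega>'. G y \<omega>' \<partial>M)" for y
      using measurable_compose[OF measurable_Pair1' G(1), of y]
      by (intro integral_distr[OF idf]) simp
    then show ?thesis by simp
  qed
  finally show ?thesis .
qed

end


subsection \<open>The heat semigroup and path integrals\<close>

text \<open>The factor \<open>exp b\<close> is kept on purpose: multiplied by the bound
  \<open>exp (j * b)\<close> for \<open>j\<close> cells it gives the bound for \<open>Suc j\<close>
  cells, times the small factor \<open>b\<close>.\<close>

lemma abs_exp_minus_one_le:
  fixes u b :: real
  assumes "\<bar>u\<bar> \<le> b"
  shows "\<bar>exp u - 1\<bar> \<le> b * exp b"
proof -
  have 1: "exp b - 1 \<le> b * exp b"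
    using mult_right_mono[OF exp_ge_add_one_self[of "- b"], of "exp b"]
    by (simp add: algebra_simps flip: exp_add)
  have "1 - exp u \<le> - u" using exp_ge_add_one_self[of u] by linarith
  also have "\<dots> \<le> b * 1" using assms by linarith
  also have "\<dots> \<le> b * exp b" using assms by (intro mult_left_mono) auto
  finally have "1 - exp u \<le> b * exp b" .
  moreover have "exp u \<le> exp b" using assms by simp
  ultimately show ?thesis using 1 by linarith
qed

lemma exp_second_order:
  fixes u b :: real
  assumes "\<bar>u\<bar> \<le> b"
  shows "\<bar>exp u - 1 - u\<bar> \<le> b\<^sup>2 / 2 * exp b"
proof -
  obtain \<theta> where \<theta>: "\<bar>\<theta>\<bar> \<le> \<bar>u\<bar>" "exp u = (\<Sum>m<2. u ^ m / fact m) + exp \<theta> / fact 2 * u ^ 2"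
    using Maclaurin_exp_le[of u 2] by auto
  have "exp u - 1 - u = u\<^sup>2 / 2 * exp \<theta>"
    using \<theta>(2) by (simp add: numeral_2_eq_2)
  moreover have "u\<^sup>2 / 2 * exp \<theta> \<le> b\<^sup>2 / 2 * exp b"
    using assms \<theta>(1) by (intro mult_mono divide_right_mono) (auto simp: abs_le_square_iff[symmetric])
  moreover have "0 \<le> u\<^sup>2 / 2 * exp \<theta>" by simp
  ultimately show ?thesis by linarith
qed

text \<open>Linearises the exchange of one exponential factor for another. The linear part can be
  integrated over the cell and averaged, which is where cancellation occurs; the two remainders of
  \<open>b\<^sup>2 / 2 * exp b\<close> are of order \<open>d\<^sup>2\<close>.\<close>

lemma exp_difference_second_order:
  fixes u v b :: real
  assumes "\<bar>u\<bar> \<le> b" "\<bar>v\<bar> \<le> b"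
  shows "\<bar>(exp u - exp v) - (u - v)\<bar> \<le> b\<^sup>2 * exp b"
  using exp_second_order[OF assms(1)] exp_second_order[OF assms(2)] by linarith

context prob_space
begin

lemma integrable_bounded:
  fixes Z :: "'a \<Rightarrow> real"
  assumes "Z \<in> borel_measurable M" "\<And>\<omega>. \<omega> \<in> space M \<Longrightarrow> \<bar>Z \<omega>\<bar> \<le> c"
  shows "integrable M Z"
  using assms by (intro integrable_const_bound[of _ c]) auto

lemma expectation_abs_le:
  fixes Z :: "'a \<Rightarrow> real"
  assumes "Z \<in> borel_measurable M" "\<And>\<omega>. \<omega> \<in> space M \<Longrightarrow> \<bar>Z \<omega>\<bar> \<le> c"
  shows "\<bar>expectation Z\<bar> \<le> c"
proof -
  have "\<bar>expectation Z\<bar> \<le> expectation (\<lambda>\<omega>. \<bar>Z \<omega>\<bar>)"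
    by (rule integral_abs_bound)
  also have "\<dots> \<le> expectation (\<lambda>\<omega>. c)"
    using assms by (intro integral_mono integrable_abs integrable_bounded[OF assms]) auto
  finally show ?thesis by (simp add: prob_space)
qed

text \<open>By Fubini it is enough to control the expectation at each fixed time, although nothing
  is small along individual paths.\<close>

lemma expectation_integral_le:
  fixes D :: "real \<Rightarrow> 'a \<Rightarrow> real"
  assumes D: "(\<lambda>(q, \<omega>). D q \<omega>) \<in> borel_measurable (lborel \<Otimes>\<^sub>M M)"
    "\<And>q \<omega>. \<omega> \<in> space M \<Longrightarrow> \<bar>D q \<omega>\<bar> \<le> c"
    and r: "r \<le> v"
    and le: "\<And>q. r < q \<Longrightarrow> q \<le> v \<Longrightarrow> \<bar>expectation (D q)\<bar> \<le> \<kappa>"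
  shows "\<bar>expectation (\<lambda>\<omega>. LBINT q:{r<..v}. D q \<omega>)\<bar> \<le> (v - r) * \<kappa>"
proof -
  interpret L: pair_sigma_finite lborel M ..
  have c: "0 \<le> c" using D(2) not_empty abs_ge_zero order_trans by blast
  have i1: "integrable lborel (\<lambda>q. indicator {r<..v} q * k)" for k :: real
    by (intro integrable_mult_left integrable_real_indicator) (use r in auto)
  have "integrable (lborel \<Otimes>\<^sub>M M) (\<lambda>p. indicator ({r<..v} \<times> space M) p *\<^sub>R c)"
    by (intro integrable_scaleR_left integrable_real_indicator)
       (use r in \<open>auto simp: emeasure_pair_measure_Times emeasure_space_1\<close>)
  then have int: "integrable (lborel \<Otimes>\<^sub>M M) (\<lambda>(q, \<omega>). indicator {r<..v} q *\<^sub>R D q \<omega>)"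
    using D c
    by (elim Bochner_Integration.integrable_bound)
       (auto simp: space_pair_measure indicator_def case_prod_unfold intro!: AE_I2)
  have "expectation (\<lambda>\<omega>. LBINT q:{r<..v}. D q \<omega>)
      = (LBINT q. expectation (\<lambda>\<omega>. indicator {r<..v} q *\<^sub>R D q \<omega>))"
    unfolding set_lebesgue_integral_def by (rule L.Fubini_integral[OF int])
  also have "\<bar>\<dots>\<bar> \<le> (LBINT q. \<bar>expectation (\<lambda>\<omega>. indicator {r<..v} q *\<^sub>R D q \<omega>)\<bar>)"
    by (rule integral_abs_bound)
  also have "\<dots> \<le> (LBINT q. indicator {r<..v} q * \<kappa>)"
    using le by (intro integral_mono integrable_abs L.integrable_fst[OF int] i1)
      (auto simp: indicator_def)
  also have "\<dots> = (v - r) * \<kappa>"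
    using r by simp
  finally show ?thesis .
qed

end

section \<open>Transition semigroup and Markov property\<close>

context levy_process
begin

text \<open>The transition semigroup of \<open>W\<close>. For centred Brownian motion it is the heat
  semigroup generated by half the Laplacian.\<close>

definition heat :: "real \<Rightarrow> ('a \<Rightarrow> real) \<Rightarrow> 'a \<Rightarrow> real" where
  "heat s \<phi> y = expectation (\<lambda>\<omega>. \<phi> (y + W s \<omega>))"

lemma W_diff_measurable: "0 \<le> u \<Longrightarrow> 0 \<le> v \<Longrightarrow> (\<lambda>\<omega>. W v \<omega> - W u \<omega>) \<in> borel_measurable M"
  by (intro borel_measurable_diff W_measurable)

lemma heat_increment:
  assumes "0 \<le> u" "u \<le> v" and \<phi>: "\<phi> \<in> borel_measurable borel"
  shows "expectation (\<lambda>\<omega>. \<phi> (y + (W v \<omega> - W u \<omega>))) = heat (v - u) \<phi> y"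
proof -
  have m: "(\<lambda>z. \<phi> (y + z)) \<in> borel_measurable borel"
    using \<phi> by measurable
  have "expectation (\<lambda>\<omega>. \<phi> (y + (W v \<omega> - W u \<omega>)))
      = (\<integral>z. \<phi> (y + z) \<partial>distr M borel (\<lambda>\<omega>. W v \<omega> - W u \<omega>))"
    using assms by (intro integral_distr[symmetric] W_diff_measurable m) auto
  also have "\<dots> = (\<integral>z. \<phi> (y + z) \<partial>distr M borel (W (v - u)))"
    using assms by (simp add: W_stationary)
  also have "\<dots> = heat (v - u) \<phi> y"
    unfolding heat_def using assms by (intro integral_distr m W_measurable) auto
  finally show ?thesis .
qed

lemma heat_0 [simp]: "heat 0 \<phi> y = \<phi> y"
  by (simp add: heat_def W_0 prob_space)

lemma heat_measurable:
  assumes "0 \<le> s" and \<phi>: "\<phi> \<in> borel_measurable borel"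
  shows "heat s \<phi> \<in> borel_measurable borel"
proof -
  have "(\<lambda>p. fst p + W s (snd p)) \<in> borel_measurable (borel \<Otimes>\<^sub>M M)"
    using W_measurable[OF assms(1)] by measurable
  from measurable_compose[OF this \<phi>]
  have "(\<lambda>(y, \<omega>). \<phi> (y + W s \<omega>)) \<in> borel_measurable (borel \<Otimes>\<^sub>M M)"
    by (simp add: case_prod_unfold)
  then show ?thesis
    unfolding heat_def by (rule borel_measurable_lebesgue_integral)
qed

lemma heat_bounded:
  assumes "0 \<le> s" and "\<phi> \<in> borel_measurable borel" and "\<And>y. \<bar>\<phi> y\<bar> \<le> \<beta>"
  shows "\<bar>heat s \<phi> y\<bar> \<le> \<beta>"
  unfolding heat_def
  using assms by (intro expectation_abs_le measurable_compose[OF _ assms(2)] borel_measurable_add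
      W_measurable) auto

lemma heat_diff_eq:
  assumes "0 \<le> s" and "\<phi> \<in> borel_measurable borel" "\<And>y. \<bar>\<phi> y\<bar> \<le> \<beta>"
    and "\<psi> \<in> borel_measurable borel" "\<And>y. \<bar>\<psi> y\<bar> \<le> \<gamma>"
  shows "heat s (\<lambda>z. \<phi> z - \<psi> z) y = heat s \<phi> y - heat s \<psi> y"
  unfolding heat_def using assms
  by (intro Bochner_Integration.integral_diff integrable_bounded
      measurable_compose[OF _ assms(2)] measurable_compose[OF _ assms(4)]
      borel_measurable_add W_measurable) auto

lemma markov_heat:
  fixes Z :: "'w \<Rightarrow> real" and \<xi> :: "'w \<Rightarrow> 'a"
  assumes v: "0 \<le> v" "v \<le> s"
    and Z: "Z \<in> borel_measurable (past v)" "\<And>\<omega>. \<omega> \<in> space M \<Longrightarrow> \<bar>Z \<omega>\<bar> \<le> c"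
    and \<xi>: "\<xi> \<in> borel_measurable (past v)"
    and \<phi>: "\<phi> \<in> borel_measurable borel" "\<And>y. \<bar>\<phi> y\<bar> \<le> \<beta>"
  shows "expectation (\<lambda>\<omega>. Z \<omega> * \<phi> (\<xi> \<omega> + (W s \<omega> - W v \<omega>)))
    = expectation (\<lambda>\<omega>. Z \<omega> * heat (s - v) \<phi> (\<xi> \<omega>))"
proof -
  have "(\<lambda>p. fst p + (W s (snd p) - W v (snd p))) \<in> borel_measurable (borel \<Otimes>\<^sub>M future v)"
    using W_future[OF v(2)] by measurable
  from measurable_compose[OF this \<phi>(1)]
  have "case_prod (\<lambda>y \<omega>. \<phi> (y + (W s \<omega> - W v \<omega>))) \<in> borel_measurable (borel \<Otimes>\<^sub>M future v)"
    by (simp add: case_prod_unfold)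
  from markov[OF v(1) Z \<xi> this \<phi>(2)] show ?thesis
    by (simp add: heat_increment[OF v \<phi>(1)])
qed

text \<open>The semigroup law is the Markov property at time \<open>s\<close> with weight 1, so no
  convolution of Gaussian densities has to be computed.\<close>

lemma heat_heat:
  assumes "0 \<le> s" "0 \<le> r" and \<phi>: "\<phi> \<in> borel_measurable borel" "\<And>y. \<bar>\<phi> y\<bar> \<le> \<beta>"
  shows "heat s (heat r \<phi>) y = heat (s + r) \<phi> y"
proof -
  have "expectation (\<lambda>\<omega>. 1 * \<phi> (y + W s \<omega> + (W (s + r) \<omega> - W s \<omega>)))
      = expectation (\<lambda>\<omega>. 1 * heat (s + r - s) \<phi> (y + W s \<omega>))"
    using assms
    by (intro markov_heat[where c = 1 and \<beta> = \<beta>] borel_measurable_add W_past) auto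
  then show ?thesis
    unfolding heat_def[of "s + r"] heat_def[of s "heat r \<phi>"] by simp
qed

text \<open>\<open>max u\<close> holds the process constant before \<open>u\<close>. The result is
  continuous on the whole real line, and each of its values is still measurable with respect to
  \<open>future u\<close>.\<close>

lemma increments_jointly_measurable:
  assumes "0 \<le> u"
  shows "(\<lambda>p. W (max u (snd p)) (fst p) - W u (fst p)) \<in> borel_measurable (future u \<Otimes>\<^sub>M borel)"
proof (rule borel_measurable_continuous_process)
  fix \<omega> assume "\<omega> \<in> space (future u)"
  then have "continuous_on {0..} (\<lambda>q. W q \<omega>)" by (simp add: W_continuous)
  then have "continuous_on UNIV (\<lambda>q. W (max u q) \<omega>)"
    using assms
    by (intro continuous_on_compose2[of "{0..}" "\<lambda>q. W q \<omega>" UNIV "max u"])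
       (auto intro!: continuous_intros)
  then show "continuous_on UNIV (\<lambda>q. W (max u q) \<omega> - W u \<omega>)"
    by (intro continuous_on_diff continuous_on_const)
qed (auto intro!: W_future)

end

section \<open>Time integrals of a bounded potential\<close>

locale potential_process = levy_process M W
  for M :: "'w measure" and W :: "real \<Rightarrow> 'w \<Rightarrow> 'a::euclidean_space" +
  fixes h :: "'a \<Rightarrow> real" and H :: real
  assumes h_measurable: "h \<in> borel_measurable borel"
    and h_bounded: "\<bar>h y\<bar> \<le> H"
begin

lemma H_nonneg: "0 \<le> H"
  using h_bounded[of 0] by linarith

text \<open>The starting point \<open>y\<close> is a separate argument and only increments after
  \<open>u\<close> occur: for frozen \<open>y\<close> this is a function of the future of
  \<open>u\<close>, the shape that \<open>markov\<close> asks for. Left-open intervals make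
  consecutive integrals add over disjoint sets.\<close>

definition path_integral :: "real \<Rightarrow> real \<Rightarrow> 'a \<Rightarrow> 'w \<Rightarrow> real" where
  "path_integral u v y \<omega> = (LBINT q:{u<..v}. h (y + (W q \<omega> - W u \<omega>)))"

lemma potential_jointly_measurable:
  assumes "0 \<le> u"
  shows "(\<lambda>p. h (fst (fst p) + (W (max u (snd p)) (snd (fst p)) - W u (snd (fst p)))))
    \<in> borel_measurable ((borel \<Otimes>\<^sub>M future u) \<Otimes>\<^sub>M borel)"
proof -
  have "(\<lambda>p. (snd (fst p), snd p)) \<in> measurable (((borel :: 'a measure) \<Otimes>\<^sub>M future u) \<Otimes>\<^sub>M (borel :: real measure))
      (future u \<Otimes>\<^sub>M borel)"
    by measurable
  from measurable_compose[OF this increments_jointly_measurable[OF assms]]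
  have [measurable]: "(\<lambda>p. W (max u (snd p)) (snd (fst p)) - W u (snd (fst p)))
      \<in> borel_measurable (((borel :: 'a measure) \<Otimes>\<^sub>M future u) \<Otimes>\<^sub>M (borel :: real measure))"
    by simp
  have "(\<lambda>p. fst (fst p) + (W (max u (snd p)) (snd (fst p)) - W u (snd (fst p))))
      \<in> borel_measurable (((borel :: 'a measure) \<Otimes>\<^sub>M future u) \<Otimes>\<^sub>M (borel :: real measure))"
    by measurable
  from measurable_compose[OF this h_measurable] show ?thesis .
qed

lemma path_integral_max:
  "path_integral u v y \<omega> = (LBINT q:{u<..v}. h (y + (W (max u q) \<omega> - W u \<omega>)))"
  unfolding path_integral_def by (rule set_lebesgue_integral_cong) (auto simp: max_def)

lemma path_integral_measurable:
  assumes "0 \<le> u"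
  shows "case_prod (path_integral u v) \<in> borel_measurable (borel \<Otimes>\<^sub>M future u)"
proof -
  have "(\<lambda>p. h (fst (fst p) + (W (max u (snd p)) (snd (fst p)) - W u (snd (fst p)))))
    \<in> borel_measurable ((borel \<Otimes>\<^sub>M future u) \<Otimes>\<^sub>M lborel)"
    using potential_jointly_measurable[OF assms] by (simp cong: measurable_cong_sets sets_pair_measure_cong)
  then have "(\<lambda>(p, q). indicator {u<..v} q *\<^sub>R h (fst p + (W (max u q) (snd p) - W u (snd p))))
      \<in> borel_measurable ((borel \<Otimes>\<^sub>M future u) \<Otimes>\<^sub>M lborel)"
    unfolding case_prod_unfold by measurable
  then have "(\<lambda>p. LBINT q. indicator {u<..v} q *\<^sub>R h (fst p + (W (max u q) (snd p) - W u (snd p))))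
      \<in> borel_measurable (borel \<Otimes>\<^sub>M future u)"
    by (rule lborel.borel_measurable_lebesgue_integral)
  then show ?thesis
    by (simp add: case_prod_unfold path_integral_max set_lebesgue_integral_def)
qed

lemma potential_set_integrable:
  assumes "0 \<le> u" "\<omega> \<in> space M"
  shows "set_integrable lborel {u<..v} (\<lambda>q. h (y + (W q \<omega> - W u \<omega>)))"
proof -
  have "emeasure lborel {u<..v} < \<infinity>"
    by (cases "u \<le> v") auto
  moreover have "(\<lambda>q. h (y + (W (max u q) \<omega> - W u \<omega>))) \<in> borel_measurable borel"
    using measurable_compose[OF measurable_Pair1' potential_jointly_measurable[OF assms(1)], of "(y, \<omega>)"]
      assms(2) by (simp add: space_pair_measure)
  ultimately have "set_integrable lborel {u<..v} (\<lambda>q. h (y + (W (max u q) \<omega> - W u \<omega>)))"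
    unfolding set_integrable_def
    by (intro integrableI_bounded_set_indicator[of _ _ _ H]) (auto simp: h_bounded)
  then show ?thesis
    by (rule set_integrable_cong[THEN iffD1, rotated -1]) (auto simp: max_def)
qed

lemma path_integral_bounded:
  assumes "0 \<le> u" "u \<le> v" "\<omega> \<in> space M"
  shows "\<bar>path_integral u v y \<omega>\<bar> \<le> H * (v - u)"
proof -
  have "\<bar>path_integral u v y \<omega>\<bar> \<le> (LBINT q. \<bar>indicator {u<..v} q *\<^sub>R h (y + (W q \<omega> - W u \<omega>))\<bar>)"
    unfolding path_integral_def set_lebesgue_integral_def by (rule integral_abs_bound)
  also have "\<dots> \<le> (LBINT q. indicator {u<..v} q * H)"
    using potential_set_integrable[OF assms(1,3), of v y] assms(2)
    by (intro integral_mono integrable_abs integrable_mult_left integrable_real_indicator) (auto simp: set_integrable_def indicator_def h_bounded)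
  finally show ?thesis using assms by (simp add: mult.commute)
qed

lemma path_integral_split:
  assumes "0 \<le> u" "u \<le> v" "v \<le> w" "\<omega> \<in> space M"
  shows "path_integral u w y \<omega> = path_integral u v y \<omega> + path_integral v w (y + (W v \<omega> - W u \<omega>)) \<omega>"
proof -
  have *: "{u<..w} = {u<..v} \<union> {v<..w}" using assms by auto
  have "set_integrable lborel {v<..w} (\<lambda>q. h (y + (W v \<omega> - W u \<omega>) + (W q \<omega> - W v \<omega>)))"
    using assms by (intro potential_set_integrable) auto
  then have "set_integrable lborel {v<..w} (\<lambda>q. h (y + (W q \<omega> - W u \<omega>)))"
    by (simp add: algebra_simps)
  then have "path_integral u w y \<omega> = path_integral u v y \<omega> + (LBINT q:{v<..w}. h (y + (W q \<omega> - W u \<omega>)))"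
    unfolding path_integral_def * using assms by (intro set_integral_Un potential_set_integrable) auto
  also have "(LBINT q:{v<..w}. h (y + (W q \<omega> - W u \<omega>))) = path_integral v w (y + (W v \<omega> - W u \<omega>)) \<omega>"
    unfolding path_integral_def by (simp add: algebra_simps)
  finally show ?thesis .
qed

end


subsection \<open>Smoothing by the past and by the future\<close>

lemma sum_inverse_reversed: "(\<Sum>i<m. 1 / real (m - i)) = harm m"
proof -
  have "(\<Sum>i<m. 1 / real (m - i)) = (\<Sum>i<m. 1 / real (Suc i))"
    by (subst sum.nat_diff_reindex[symmetric]) (auto intro!: sum.cong simp: Suc_diff_Suc)
  also have "\<dots> = harm m"
    by (simp add: harm_altdef inverse_eq_divide)
  finally show ?thesis .
qed

text \<open>Origin of the factor 6. At \<open>n = 2\<close> it is \<open>4 \<le> 6 * ln 2\<close>,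
  which follows from \<open>ln 2 \<ge> 2 / 3\<close>. From \<open>k\<close> to \<open>k + 1\<close>
  the left side grows by \<open>2 / (k - 1)\<close>, at most \<open>6 / (k + 1)\<close> because
  \<open>k \<ge> 2\<close>, and the right side by at least \<open>6 / (k + 1)\<close>.\<close>

lemma harm_le_ln:
  assumes "2 \<le> n"
  shows "4 + 2 * harm (n - 2) \<le> 6 * ln (real n)"
  using assms
proof (induction n rule: dec_induct)
  case base
  show ?case using ln2_ge_two_thirds by (simp add: harm_def)
next
  case (step k)
  have "ln (real k / real (Suc k)) \<le> real k / real (Suc k) - 1"
    using step.hyps by (intro ln_le_minus_one) auto
  then have "1 / real (Suc k) \<le> ln (real (Suc k)) - ln (real k)"
    using step.hyps by (simp add: ln_div field_simps)
  moreover have "1 / real (k - 1) \<le> 3 * (1 / real (Suc k))"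
    using step.hyps by (auto simp: of_nat_diff field_simps)
  moreover have "harm (Suc k - 2) = harm (k - 2) + 1 / real (k - 1)"
  proof -
    have "Suc k - 2 = Suc (k - 2)" "real (Suc (k - 2)) = real (k - 1)" using step.hyps by auto
    then show ?thesis by (simp only: harm_Suc inverse_eq_divide)
  qed
  ultimately show ?case using step.IH by argo
qed

text \<open>\<open>d\<close> is the mesh and \<open>real n * d\<close> the final time. Of the
  Gaussian kernel only \<open>heat_regular\<close> remains: total variation regularity in time,
  uniform in the starting point.\<close>

locale lattice_approximation = potential_process M W h H
  for M :: "'w measure" and W :: "real \<Rightarrow> 'w \<Rightarrow> 'a::euclidean_space"
    and h :: "'a \<Rightarrow> real" and H :: real +
  fixes f :: "'a \<Rightarrow> real" and \<beta> lam C T d :: real and n :: nat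
  assumes f_measurable: "f \<in> borel_measurable borel"
    and f_bounded: "\<bar>f y\<bar> \<le> \<beta>"
    and lam_nonneg: "0 \<le> lam" and C_nonneg: "0 \<le> C"
    and d_pos: "0 < d" and horizon: "real n * d \<le> T"
    and heat_regular: "\<lbrakk>0 < r; r \<le> s; s \<le> T; \<phi> \<in> borel_measurable borel; \<And>y. \<bar>\<phi> y\<bar> \<le> \<gamma>\<rbrakk>
      \<Longrightarrow> \<bar>heat s \<phi> y - heat r \<phi> y\<bar> \<le> \<gamma> * (C * ((s - r) / r))"
begin

text \<open>The largest change of the exponent within one cell, for the sum and for the integral
  alike; \<open>n\<close> cells amount to \<open>lam * H\<close> times the final time.\<close>

definition b :: real where "b = lam * H * d"

definition exp_sum :: "'a \<Rightarrow> nat \<Rightarrow> 'w \<Rightarrow> real" where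
  "exp_sum x j \<omega> = exp (lam * d * (\<Sum>i<j. h (x + W (real i * d) \<omega>)))"

definition tail :: "nat \<Rightarrow> 'a \<Rightarrow> 'w \<Rightarrow> real" where
  "tail i y \<omega> = exp (lam * path_integral (real i * d) (real n * d) y \<omega>)
    * f (y + (W (real n * d) \<omega> - W (real i * d) \<omega>))"

text \<open>By stationarity this is the Feynman-Kac semigroup over the remaining
  \<open>n - i\<close> cells, applied to \<open>f\<close> and evaluated at \<open>y\<close>.\<close>

definition tail_value :: "nat \<Rightarrow> 'a \<Rightarrow> real" where
  "tail_value i y = expectation (tail i y)"

lemma b_nonneg: "0 \<le> b"
  using lam_nonneg H_nonneg d_pos by (simp add: b_def)

lemma \<beta>_nonneg: "0 \<le> \<beta>"
  using f_bounded[of 0] by linarith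

lemma lam_h_le: "\<bar>lam * d * h y\<bar> \<le> b"
proof -
  have "\<bar>lam * d * h y\<bar> = (lam * d) * \<bar>h y\<bar>"
    using lam_nonneg d_pos by (simp add: abs_mult)
  also have "\<dots> \<le> (lam * d) * H"
    using lam_nonneg d_pos h_bounded[of y] by (intro mult_left_mono) auto
  finally show ?thesis by (simp add: b_def algebra_simps)
qed

text \<open>The last sample in \<open>exp_sum x j\<close> is taken at \<open>(j - 1) * d\<close>,
  one cell before \<open>j * d\<close>; hence the slack \<open>d\<close>. It makes the increment
  from \<open>i\<close> to \<open>Suc i\<close> known already at time \<open>i * d\<close>.\<close>

lemma exp_sum_past:
  assumes "real j * d \<le> v + d" "0 \<le> v"
  shows "exp_sum x j \<in> borel_measurable (past v)"
proof -
  have "(\<lambda>\<omega>. h (x + W (real i * d) \<omega>)) \<in> borel_measurable (past v)" if "i < j" for i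
  proof (intro measurable_compose[OF _ h_measurable] borel_measurable_add W_past)
    have "(real i + 1) * d \<le> real j * d" using that d_pos by (intro mult_right_mono) auto
    then show "real i * d \<le> v" using assms by (simp add: algebra_simps)
  qed (use d_pos in auto)
  then show ?thesis
    unfolding exp_sum_def
    by (intro borel_measurable_exp[THEN measurable_compose[rotated]] borel_measurable_times borel_measurable_sum) auto
qed

lemma exp_sum_0 [simp]: "exp_sum x 0 \<omega> = 1"
  by (simp add: exp_sum_def)

lemma exp_sum_Suc: "exp_sum x (Suc j) \<omega> = exp_sum x j \<omega> * exp (lam * d * h (x + W (real j * d) \<omega>))"
  by (simp add: exp_sum_def distrib_left exp_add)

lemma exp_sum_bounded: "\<bar>exp_sum x j \<omega>\<bar> \<le> exp (real j * b)"
proof (induction j)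
  case (Suc j)
  have "\<bar>exp_sum x (Suc j) \<omega>\<bar> \<le> exp (real j * b) * exp b"
    unfolding exp_sum_Suc abs_mult using Suc lam_h_le[of "x + W (real j * d) \<omega>"]
    by (intro mult_mono) (auto simp: abs_le_iff)
  then show ?case by (simp add: exp_add[symmetric] algebra_simps)
qed simp

lemma exp_sum_step: "\<bar>exp_sum x (Suc j) \<omega> - exp_sum x j \<omega>\<bar> \<le> b * exp (real (Suc j) * b)"
proof -
  have "\<bar>exp_sum x (Suc j) \<omega> - exp_sum x j \<omega>\<bar>
      = \<bar>exp_sum x j \<omega>\<bar> * \<bar>exp (lam * d * h (x + W (real j * d) \<omega>)) - 1\<bar>"
    unfolding exp_sum_Suc by (simp add: abs_mult[symmetric] right_diff_distrib)
  also have "\<dots> \<le> exp (real j * b) * (b * exp b)"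
    by (intro mult_mono exp_sum_bounded abs_exp_minus_one_le lam_h_le) auto
  also have "\<dots> = b * exp (real (Suc j) * b)"
    by (simp add: distrib_right exp_add)
  finally show ?thesis .
qed

lemma grid_mono: "i \<le> k \<Longrightarrow> real i * d \<le> real k * d"
  using d_pos by (intro mult_right_mono) auto

lemma grid_nonneg [simp]: "0 \<le> real i * d"
  using d_pos by simp

lemma tail_measurable:
  assumes "i \<le> n"
  shows "case_prod (tail i) \<in> borel_measurable (borel \<Otimes>\<^sub>M future (real i * d))"
proof -
  have [measurable]: "(\<lambda>p. path_integral (real i * d) (real n * d) (fst p) (snd p))
      \<in> borel_measurable (borel \<Otimes>\<^sub>M future (real i * d))"
    using path_integral_measurable[of "real i * d" "real n * d"] by (simp add: case_prod_unfold)
  have "(\<lambda>p. fst p + (W (real n * d) (snd p) - W (real i * d) (snd p)))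
      \<in> borel_measurable (borel \<Otimes>\<^sub>M future (real i * d))"
    using W_future[OF grid_mono[OF assms]] by measurable
  from measurable_compose[OF this f_measurable]
  have [measurable]: "(\<lambda>p. f (fst p + (W (real n * d) (snd p) - W (real i * d) (snd p))))
      \<in> borel_measurable (borel \<Otimes>\<^sub>M future (real i * d))" .
  show ?thesis
    unfolding tail_def case_prod_unfold by measurable
qed

lemma tail_measurable_M:
  assumes "i \<le> n" "\<xi> \<in> borel_measurable M"
  shows "(\<lambda>\<omega>. tail i (\<xi> \<omega>) \<omega>) \<in> borel_measurable M"
proof -
  have "(\<lambda>\<omega>. \<omega>) \<in> measurable M (future (real i * d))"
    using measurable_future_le[of "real i * d" id "future (real i * d)"] by (simp add: id_def)
  with assms(2) have "(\<lambda>\<omega>. (\<xi> \<omega>, \<omega>)) \<in> measurable M (borel \<Otimes>\<^sub>M future (real i * d))"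
    by measurable
  from measurable_compose[OF this tail_measurable[OF assms(1)]] show ?thesis by simp
qed

lemma lam_path_integral_le:
  assumes "i \<le> k" "\<omega> \<in> space M"
  shows "\<bar>lam * path_integral (real i * d) (real k * d) y \<omega>\<bar> \<le> real (k - i) * b"
proof -
  have "\<bar>lam * path_integral (real i * d) (real k * d) y \<omega>\<bar>
      \<le> lam * (H * (real k * d - real i * d))"
    unfolding abs_mult using lam_nonneg assms
    by (simp add: mult_left_mono path_integral_bounded grid_mono)
  also have "\<dots> = real (k - i) * b"
    using assms by (simp add: b_def of_nat_diff algebra_simps)
  finally show ?thesis .
qed

lemma tail_bounded:
  assumes "i \<le> n" "\<omega> \<in> space M"
  shows "\<bar>tail i y \<omega>\<bar> \<le> \<beta> * exp (real (n - i) * b)"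
proof -
  have "\<bar>tail i y \<omega>\<bar> \<le> exp (real (n - i) * b) * \<beta>"
    unfolding tail_def abs_mult using lam_path_integral_le[OF assms, of y]
    by (intro mult_mono f_bounded) auto
  then show ?thesis by (simp add: mult.commute)
qed

lemma tail_value_measurable:
  assumes "i \<le> n"
  shows "tail_value i \<in> borel_measurable borel"
proof -
  have "(\<lambda>p. (fst p, snd p)) \<in> measurable (borel \<Otimes>\<^sub>M M) (borel \<Otimes>\<^sub>M future (real i * d))"
    using measurable_compose[OF measurable_snd measurable_future_le[of "real i * d" id "future (real i * d)"]]
    by (intro measurable_Pair) (auto simp: id_def)
  from measurable_compose[OF this tail_measurable[OF assms]]
  have "case_prod (tail i) \<in> borel_measurable (borel \<Otimes>\<^sub>M M)" by simp
  then show ?thesis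
    unfolding tail_value_def by (rule borel_measurable_lebesgue_integral)
qed

lemma tail_value_bounded:
  assumes "i \<le> n"
  shows "\<bar>tail_value i y\<bar> \<le> \<beta> * exp (real (n - i) * b)"
  unfolding tail_value_def
  by (intro expectation_abs_le tail_measurable_M[OF assms] tail_bounded[OF assms]) auto

lemma tail_value_n: "tail_value n y = f y"
proof -
  have "tail n y = (\<lambda>_. f y)"
    by (simp add: tail_def path_integral_def set_lebesgue_integral_def fun_eq_iff)
  then show ?thesis by (simp add: tail_value_def prob_space)
qed

lemma tail_step:
  assumes "i < n" "\<omega> \<in> space M"
  shows "tail i y \<omega> = exp (lam * path_integral (real i * d) (real (Suc i) * d) y \<omega>)
    * tail (Suc i) (y + (W (real (Suc i) * d) \<omega> - W (real i * d) \<omega>)) \<omega>"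
proof -
  have "path_integral (real i * d) (real n * d) y \<omega>
      = path_integral (real i * d) (real (Suc i) * d) y \<omega>
      + path_integral (real (Suc i) * d) (real n * d) (y + (W (real (Suc i) * d) \<omega> - W (real i * d) \<omega>)) \<omega>"
    using assms by (intro path_integral_split grid_mono) auto
  then show ?thesis
    unfolding tail_def by (simp only: distrib_left exp_add) (simp add: algebra_simps)
qed

lemma markov_tail:
  assumes "i \<le> n" "Z \<in> borel_measurable (past (real i * d))" "\<And>\<omega>. \<omega> \<in> space M \<Longrightarrow> \<bar>Z \<omega>\<bar> \<le> c"
    and "\<xi> \<in> borel_measurable (past (real i * d))"
  shows "expectation (\<lambda>\<omega>. Z \<omega> * tail i (\<xi> \<omega>) \<omega>) = expectation (\<lambda>\<omega>. Z \<omega> * tail_value i (\<xi> \<omega>))"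
  unfolding tail_value_def
  by (rule markov[OF _ assms(2,3,4) tail_measurable[OF assms(1)] tail_bounded[OF assms(1)]]) auto

text \<open>One step of a Duhamel expansion: dropping the potential during a single cell turns the
  Feynman-Kac flow over that cell into pure heat flow, at a relative cost of order
  \<open>b\<close>.\<close>

lemma tail_value_step:
  assumes i: "i < n"
  shows "\<bar>tail_value i y - heat d (tail_value (Suc i)) y\<bar> \<le> b * (\<beta> * exp (real (n - i) * b))"
proof -
  let ?\<xi> = "\<lambda>\<omega>. y + (W (real (Suc i) * d) \<omega> - W (real i * d) \<omega>)"
  let ?e = "\<lambda>\<omega>. exp (lam * path_integral (real i * d) (real (Suc i) * d) y \<omega>)"
  have si: "Suc i \<le> n" using i by simp
  have Suc_le: "real i * d \<le> real (Suc i) * d" by (rule grid_mono) simp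
  have \<xi>: "?\<xi> \<in> borel_measurable (past (real (Suc i) * d))"
    using Suc_le grid_nonneg by (intro borel_measurable_add borel_measurable_diff W_past) (auto simp del: of_nat_Suc)
  have "expectation (\<lambda>\<omega>. 1 * tail (Suc i) (?\<xi> \<omega>) \<omega>) = expectation (\<lambda>\<omega>. 1 * tail_value (Suc i) (?\<xi> \<omega>))"
    by (rule markov_tail[OF si, where c = 1]) (use \<xi> in auto)
  also have "\<dots> = heat (real (Suc i) * d - real i * d) (tail_value (Suc i)) y"
    unfolding mult_1 by (rule heat_increment[OF grid_nonneg Suc_le tail_value_measurable[OF si]])
  also have "real (Suc i) * d - real i * d = d"
    by (simp add: distrib_right)
  finally have eq: "heat d (tail_value (Suc i)) y = expectation (\<lambda>\<omega>. tail (Suc i) (?\<xi> \<omega>) \<omega>)" by simp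
  have tm: "(\<lambda>\<omega>. tail (Suc i) (?\<xi> \<omega>) \<omega>) \<in> borel_measurable M"
    by (rule tail_measurable_M[OF si measurable_past_le[OF \<xi>]])
  have tm': "tail i y \<in> borel_measurable M"
    using tail_measurable_M[of i "\<lambda>_. y"] i by simp
  have int: "integrable M (tail i y)" "integrable M (\<lambda>\<omega>. tail (Suc i) (?\<xi> \<omega>) \<omega>)"
    using integrable_bounded[OF tm' tail_bounded[OF less_imp_le[OF i]]]
      integrable_bounded[OF tm tail_bounded[OF si]] by auto
  have "tail_value i y - heat d (tail_value (Suc i)) y
      = expectation (\<lambda>\<omega>. tail i y \<omega> - tail (Suc i) (?\<xi> \<omega>) \<omega>)"
    unfolding eq tail_value_def[of i] using int by simp
  moreover have "\<bar>expectation (\<lambda>\<omega>. tail i y \<omega> - tail (Suc i) (?\<xi> \<omega>) \<omega>)\<bar> \<le> b * (\<beta> * exp (real (n - i) * b))"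
  proof (rule expectation_abs_le)
    fix \<omega> assume \<omega>: "\<omega> \<in> space M"
    have "\<bar>tail i y \<omega> - tail (Suc i) (?\<xi> \<omega>) \<omega>\<bar> = \<bar>?e \<omega> - 1\<bar> * \<bar>tail (Suc i) (?\<xi> \<omega>) \<omega>\<bar>"
      unfolding tail_step[OF i \<omega>] by (simp add: abs_mult[symmetric] left_diff_distrib)
    also have "\<dots> \<le> (b * exp b) * (\<beta> * exp (real (n - Suc i) * b))"
      using lam_path_integral_le[of i "Suc i" \<omega> y] \<omega> b_nonneg
      by (intro mult_mono abs_exp_minus_one_le tail_bounded[OF si]) auto
    also have "\<dots> = b * (\<beta> * exp (b + real (n - Suc i) * b))"
      by (simp add: exp_add)
    also have "b + real (n - Suc i) * b = real (n - i) * b"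
      using i by (simp add: of_nat_diff algebra_simps)
    finally show "\<bar>tail i y \<omega> - tail (Suc i) (?\<xi> \<omega>) \<omega>\<bar> \<le> b * (\<beta> * exp (real (n - i) * b))" .
  qed (use tm tm' in measurable)
  ultimately show ?thesis by simp
qed

section \<open>The two smoothing estimates for one cell\<close>

text \<open>By the Markov property at \<open>u\<close> both terms become heat flows evaluated at the
  same point, for times \<open>s - u\<close> and \<open>r - u\<close>. Their difference is what
  \<open>heat_regular\<close> controls, and it gains from the distance \<open>r - u\<close>.\<close>

lemma smooth_past_single:
  assumes u: "0 \<le> u" "u < r" "r \<le> s" "s \<le> T"
    and Z: "Z \<in> borel_measurable (past u)" "\<And>\<omega>. \<omega> \<in> space M \<Longrightarrow> \<bar>Z \<omega>\<bar> \<le> c"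
    and k: "k \<in> borel_measurable borel" "\<And>y. \<bar>k y\<bar> \<le> \<kappa>"
  shows "\<bar>expectation (\<lambda>\<omega>. Z \<omega> * (k (x + W s \<omega>) - k (x + W r \<omega>)))\<bar>
    \<le> c * (\<kappa> * (C * ((s - r) / (r - u))))"
proof -
  let ?Y = "\<lambda>q \<omega>. x + W q \<omega>"
  have Y: "?Y q \<in> borel_measurable M" if "0 \<le> q" for q
    using that by (intro borel_measurable_add W_measurable) auto
  have Yu: "?Y u \<in> borel_measurable (past u)" using u by (intro borel_measurable_add W_past) auto
  have ZM: "Z \<in> borel_measurable M" by (rule measurable_past_le[OF Z(1)])
  have c0: "0 \<le> c" and \<kappa>0: "0 \<le> \<kappa>"
    using Z(2) k(2)[of 0] not_empty abs_ge_zero order_trans by (blast, linarith)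
  have Zk: "integrable M (\<lambda>\<omega>. Z \<omega> * \<phi> (?Y q \<omega>))"
    if "0 \<le> q" "\<phi> \<in> borel_measurable borel" "\<And>y. \<bar>\<phi> y\<bar> \<le> \<kappa>" for q \<phi>
    by (rule integrable_bounded[of _ "c * \<kappa>"])
       (use ZM Z(2) c0 that measurable_compose[OF Y[OF that(1)] that(2)] in \<open>auto simp: abs_mult intro!: mult_mono\<close>)
  have m: "expectation (\<lambda>\<omega>. Z \<omega> * k (?Y q \<omega>)) = expectation (\<lambda>\<omega>. Z \<omega> * heat (q - u) k (?Y u \<omega>))"
    if "u \<le> q" for q
    using markov_heat[OF u(1) that Z Yu k] by (simp add: algebra_simps)
  have hm: "heat (q - u) k \<in> borel_measurable borel" "\<bar>heat (q - u) k y\<bar> \<le> \<kappa>" if "u \<le> q" for q y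
    using that k by (auto intro: heat_measurable heat_bounded)
  have "expectation (\<lambda>\<omega>. Z \<omega> * (k (?Y s \<omega>) - k (?Y r \<omega>)))
      = expectation (\<lambda>\<omega>. Z \<omega> * k (?Y s \<omega>)) - expectation (\<lambda>\<omega>. Z \<omega> * k (?Y r \<omega>))"
    unfolding right_diff_distrib using u k by (intro Bochner_Integration.integral_diff Zk) auto
  also have "\<dots> = expectation (\<lambda>\<omega>. Z \<omega> * heat (s - u) k (?Y u \<omega>)) - expectation (\<lambda>\<omega>. Z \<omega> * heat (r - u) k (?Y u \<omega>))"
    using u by (simp add: m)
  also have "\<dots> = expectation (\<lambda>\<omega>. Z \<omega> * heat (s - u) k (?Y u \<omega>) - Z \<omega> * heat (r - u) k (?Y u \<omega>))"
    using u hm by (intro Bochner_Integration.integral_diff[symmetric] Zk) auto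
  finally have eq: "expectation (\<lambda>\<omega>. Z \<omega> * (k (?Y s \<omega>) - k (?Y r \<omega>)))
      = expectation (\<lambda>\<omega>. Z \<omega> * heat (s - u) k (?Y u \<omega>) - Z \<omega> * heat (r - u) k (?Y u \<omega>))" .
  show ?thesis
    unfolding eq
  proof (rule expectation_abs_le)
    show "(\<lambda>\<omega>. Z \<omega> * heat (s - u) k (?Y u \<omega>) - Z \<omega> * heat (r - u) k (?Y u \<omega>)) \<in> borel_measurable M"
      using u hm by (intro borel_measurable_diff borel_measurable_times ZM measurable_compose[OF Y]) auto
    fix \<omega> assume \<omega>: "\<omega> \<in> space M"
    have "\<bar>heat (s - u) k (?Y u \<omega>) - heat (r - u) k (?Y u \<omega>)\<bar> \<le> \<kappa> * (C * ((s - u - (r - u)) / (r - u)))"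
      using u by (intro heat_regular k) auto
    then have "\<bar>Z \<omega>\<bar> * \<bar>heat (s - u) k (?Y u \<omega>) - heat (r - u) k (?Y u \<omega>)\<bar>
        \<le> c * (\<kappa> * (C * ((s - r) / (r - u))))"
      using Z(2)[OF \<omega>] c0 by (intro mult_mono) auto
    then show "\<bar>Z \<omega> * heat (s - u) k (?Y u \<omega>) - Z \<omega> * heat (r - u) k (?Y u \<omega>)\<bar>
        \<le> c * (\<kappa> * (C * ((s - r) / (r - u))))"
      by (simp add: abs_mult[symmetric] right_diff_distrib)
  qed
qed

text \<open>\<open>exp_sum x j\<close> is split into 1 plus its increments so that each summand can
  be conditioned at the time at which it becomes known. The \<open>i\<close>-th increment is of
  order \<open>b\<close> and gains \<open>C / (j - i)\<close>; these add up to
  \<open>b * C * harm j\<close>.\<close>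

lemma smooth_past:
  assumes j: "1 \<le> j" "j < n" and s: "real j * d \<le> s" "s \<le> real (Suc j) * d"
    and k: "k \<in> borel_measurable borel" "\<And>y. \<bar>k y\<bar> \<le> \<kappa>"
  shows "\<bar>expectation (\<lambda>\<omega>. exp_sum x j \<omega> * (k (x + W s \<omega>) - k (x + W (real j * d) \<omega>)))\<bar>
    \<le> exp (real j * b) * \<kappa> * (C / real j + b * C * harm j)"
proof -
  let ?r = "real j * d"
  let ?\<Delta> = "\<lambda>\<omega>. k (x + W s \<omega>) - k (x + W ?r \<omega>)"
  have s0: "0 \<le> s" using s grid_nonneg[of j] by linarith
  have \<kappa>0: "0 \<le> \<kappa>" using k(2)[of 0] by linarith
  have sT: "s \<le> T" using s horizon grid_mono[of "Suc j" n] j by auto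
  have bound: "(s - ?r) / (?r - real i * d) \<le> 1 / real (j - i)" if "i < j" for i
  proof -
    have "?r - real i * d = real (j - i) * d" using that by (simp add: of_nat_diff algebra_simps)
    then have "(s - ?r) / (?r - real i * d) = (s - ?r) / (real (j - i) * d)" by simp
    also have "\<dots> \<le> d / (real (j - i) * d)"
      using s d_pos by (intro divide_right_mono) (auto simp: algebra_simps)
    finally show ?thesis using d_pos by simp
  qed
  have single: "\<bar>expectation (\<lambda>\<omega>. Z \<omega> * ?\<Delta> \<omega>)\<bar> \<le> c * (\<kappa> * (C * (1 / real (j - i))))"
    if i: "i < j" and Z: "Z \<in> borel_measurable (past (real i * d))" "\<And>\<omega>. \<omega> \<in> space M \<Longrightarrow> \<bar>Z \<omega>\<bar> \<le> c"
    for i Z c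
  proof -
    have "0 \<le> c" using Z(2) not_empty abs_ge_zero order_trans by blast
    have "\<bar>expectation (\<lambda>\<omega>. Z \<omega> * ?\<Delta> \<omega>)\<bar> \<le> c * (\<kappa> * (C * ((s - ?r) / (?r - real i * d))))"
      using i s sT d_pos by (intro smooth_past_single Z k) auto
    also have "\<dots> \<le> c * (\<kappa> * (C * (1 / real (j - i))))"
      using \<open>0 \<le> c\<close> \<kappa>0 C_nonneg bound[OF i] by (intro mult_left_mono) auto
    finally show ?thesis .
  qed
  let ?a = "\<lambda>i \<omega>. exp_sum x (Suc i) \<omega> - exp_sum x i \<omega>"
  have a_past: "?a i \<in> borel_measurable (past (real i * d))" for i
    using d_pos grid_nonneg[of i] by (intro borel_measurable_diff exp_sum_past) (simp_all add: distrib_right)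
  have \<Delta>: "?\<Delta> \<in> borel_measurable M"
    using s0 by (intro borel_measurable_diff measurable_compose[OF _ k(1)] borel_measurable_add W_measurable) auto
  have \<Delta>_le: "\<bar>?\<Delta> \<omega>\<bar> \<le> 2 * \<kappa>" for \<omega>
    using k(2)[of "x + W s \<omega>"] k(2)[of "x + W ?r \<omega>"] by linarith
  have int: "integrable M (\<lambda>\<omega>. ?a i \<omega> * ?\<Delta> \<omega>)" for i
  proof (rule integrable_bounded[of _ "b * exp (real (Suc i) * b) * (2 * \<kappa>)"])
    fix \<omega>
    show "\<bar>?a i \<omega> * ?\<Delta> \<omega>\<bar> \<le> b * exp (real (Suc i) * b) * (2 * \<kappa>)"
      unfolding abs_mult[of "?a i \<omega>"] using exp_sum_step[of x i \<omega>] \<Delta>_le[of \<omega>] b_nonneg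
      by (intro mult_mono) auto
  qed (use measurable_past_le[OF a_past] \<Delta> in measurable)
  have int\<Delta>: "integrable M ?\<Delta>" using \<Delta> \<Delta>_le by (rule integrable_bounded)
  have "exp_sum x j \<omega> * ?\<Delta> \<omega> = ?\<Delta> \<omega> + (\<Sum>i<j. ?a i \<omega> * ?\<Delta> \<omega>)" for \<omega>
    unfolding sum_distrib_right[symmetric] sum_lessThan_telescope[of "\<lambda>i. exp_sum x i \<omega>" j]
    by (simp add: left_diff_distrib)
  then have "expectation (\<lambda>\<omega>. exp_sum x j \<omega> * ?\<Delta> \<omega>)
      = expectation (\<lambda>\<omega>. ?\<Delta> \<omega> + (\<Sum>i<j. ?a i \<omega> * ?\<Delta> \<omega>))"
    by presburger
  also have "\<dots> = expectation ?\<Delta> + expectation (\<lambda>\<omega>. \<Sum>i<j. ?a i \<omega> * ?\<Delta> \<omega>)"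
    by (intro Bochner_Integration.integral_add int\<Delta> Bochner_Integration.integrable_sum int)
  also have "expectation (\<lambda>\<omega>. \<Sum>i<j. ?a i \<omega> * ?\<Delta> \<omega>) = (\<Sum>i<j. expectation (\<lambda>\<omega>. ?a i \<omega> * ?\<Delta> \<omega>))"
    by (intro Bochner_Integration.integral_sum int)
  finally have "\<bar>expectation (\<lambda>\<omega>. exp_sum x j \<omega> * ?\<Delta> \<omega>)\<bar>
      = \<bar>expectation ?\<Delta> + (\<Sum>i<j. expectation (\<lambda>\<omega>. ?a i \<omega> * ?\<Delta> \<omega>))\<bar>"
    by (rule arg_cong)
  also have "\<dots> \<le> \<bar>expectation ?\<Delta>\<bar> + (\<Sum>i<j. \<bar>expectation (\<lambda>\<omega>. ?a i \<omega> * ?\<Delta> \<omega>)\<bar>)"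
    by (rule order_trans[OF abs_triangle_ineq add_left_mono[OF sum_abs]])
  also have "\<dots> \<le> exp (real j * b) * (\<kappa> * (C * (1 / real j)))
      + (\<Sum>i<j. b * exp (real j * b) * (\<kappa> * (C * (1 / real (j - i)))))"
  proof (intro add_mono sum_mono)
    \<comment> \<open>The leading 1 is known at time 0, so it is treated with \<open>i = 0\<close>
      and gains from the full distance of \<open>j\<close> cells.\<close>
    have "\<bar>expectation (\<lambda>\<omega>. 1 * ?\<Delta> \<omega>)\<bar> \<le> exp (real j * b) * (\<kappa> * (C * (1 / real (j - 0))))"
      using j b_nonneg by (intro single) auto
    then show "\<bar>expectation ?\<Delta>\<bar> \<le> exp (real j * b) * (\<kappa> * (C * (1 / real j)))" by simp
    fix i assume i: "i \<in> {..<j}"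
    have "\<bar>?a i \<omega>\<bar> \<le> b * exp (real j * b)" for \<omega>
    proof (rule order_trans[OF exp_sum_step])
      have "real (Suc i) * b \<le> real j * b"
        using i b_nonneg by (intro mult_right_mono) auto
      then show "b * exp (real (Suc i) * b) \<le> b * exp (real j * b)"
        using b_nonneg by (intro mult_left_mono) auto
    qed
    then show "\<bar>expectation (\<lambda>\<omega>. ?a i \<omega> * ?\<Delta> \<omega>)\<bar> \<le> b * exp (real j * b) * (\<kappa> * (C * (1 / real (j - i))))"
      using i by (intro single a_past) auto
  qed
  also have "(\<Sum>i<j. b * exp (real j * b) * (\<kappa> * (C * (1 / real (j - i)))))
      = b * exp (real j * b) * \<kappa> * C * (\<Sum>i<j. 1 / real (j - i))"
    by (simp add: sum_distrib_left mult.assoc)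
  also have "(\<Sum>i<j. 1 / real (j - i)) = harm j"
    by (rule sum_inverse_reversed)
  finally show ?thesis by (simp add: algebra_simps)
qed

text \<open>As \<open>s\<close> approaches the end of the cell, the heat time tends to 0 and direct
  regularity is lost. Repeated use of \<open>tail_value_step\<close> rewrites the flow as the heat
  flow of \<open>f\<close> from the final time plus heat flows of one-step errors of order
  \<open>b\<close> from the grid times in between. The condition on \<open>j\<close> keeps the final
  time at least one full cell beyond the present one.\<close>

lemma smooth_future:
  assumes j: "Suc (Suc j) \<le> n" and s: "real j * d \<le> s" "s \<le> real (Suc j) * d"
  shows "\<bar>heat (real (Suc j) * d - s) (tail_value (Suc j)) y
      - heat (real (Suc j) * d - real j * d) (tail_value (Suc j)) y\<bar>
    \<le> \<beta> * exp (real (n - Suc j) * b) * (C / real (n - Suc j) + b * (2 + C * harm (n - Suc (Suc j))))"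
proof -
  define p where "p = n - Suc (Suc j)"
  have n: "n = Suc (Suc (j + p))" using j by (simp add: p_def)
  define N where "N = \<beta> * exp (real (n - Suc j) * b)"
  define i where "i m = Suc (j + m)" for m
  define \<epsilon> where "\<epsilon> m z = tail_value (i m) z - heat d (tail_value (Suc (i m))) z" for m z
  define e where "e m z = heat (real (i m) * d - z) (tail_value (i m)) y" for m z
  have i_le: "i m \<le> n" if "m \<le> Suc p" for m using that by (simp add: i_def n)
  have i_lt: "i m < n" if "m \<le> p" for m using that by (simp add: i_def n)
  have z_le: "z \<le> real (i m) * d" if "z \<le> real (Suc j) * d" for z m
    using that grid_mono[of "Suc j" "i m"] by (simp add: i_def)
  have \<epsilon>_meas: "\<epsilon> m \<in> borel_measurable borel" if "m \<le> p" for m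
    unfolding \<epsilon>_def using i_lt[OF that] d_pos
    by (intro borel_measurable_diff heat_measurable tail_value_measurable) auto
  have \<epsilon>_le: "\<bar>\<epsilon> m z\<bar> \<le> b * N" if "m \<le> p" for m z
  proof -
    have "\<bar>\<epsilon> m z\<bar> \<le> b * (\<beta> * exp (real (n - i m) * b))"
      unfolding \<epsilon>_def by (rule tail_value_step[OF i_lt[OF that]])
    also have "\<dots> \<le> b * N"
      unfolding N_def using b_nonneg \<beta>_nonneg
      by (intro mult_left_mono) (auto simp: i_def intro!: mult_right_mono)
    finally show ?thesis .
  qed
  have step: "e m z - e (Suc m) z = heat (real (i m) * d - z) (\<epsilon> m) y"
    if m: "m \<le> p" and z: "z \<le> real (Suc j) * d" for m z
  proof -
    have S: "Suc (i m) \<le> n" using i_lt[OF m] by simp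
    note V = tail_value_measurable[OF S] tail_value_bounded[OF S]
    have "heat (real (i m) * d - z) (\<epsilon> m) y = heat (real (i m) * d - z) (tail_value (i m)) y
        - heat (real (i m) * d - z) (heat d (tail_value (Suc (i m)))) y"
      unfolding \<epsilon>_def using d_pos z_le[OF z, of m] i_lt[OF m]
      by (intro heat_diff_eq[OF _ _ tail_value_bounded _ heat_bounded[OF _ V]] heat_measurable V(1) tail_value_measurable)
         auto
    also have "heat (real (i m) * d - z) (heat d (tail_value (Suc (i m)))) y
        = heat (real (i m) * d - z + d) (tail_value (Suc (i m))) y"
      using d_pos z_le[OF z, of m] by (intro heat_heat[OF _ _ V]) auto
    also have "real (i m) * d - z + d = real (i (Suc m)) * d - z"
      by (simp add: i_def algebra_simps)
    also have "Suc (i m) = i (Suc m)" by (simp add: i_def)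
    finally show ?thesis by (simp add: e_def)
  qed
  have expand: "e 0 z = heat (real n * d - z) f y + (\<Sum>m\<le>p. heat (real (i m) * d - z) (\<epsilon> m) y)"
    if z: "z \<le> real (Suc j) * d" for z
  proof -
    have "(\<Sum>m\<le>p. heat (real (i m) * d - z) (\<epsilon> m) y) = (\<Sum>m<Suc p. e m z - e (Suc m) z)"
      using step[OF _ z] by (simp add: lessThan_Suc_atMost)
    also have "\<dots> = e 0 z - e (Suc p) z" by (rule sum_lessThan_telescope')
    also have "e (Suc p) z = heat (real n * d - z) f y"
      by (simp add: e_def i_def n[symmetric] tail_value_n[abs_def])
    finally show ?thesis by simp
  qed
  let ?r = "real j * d"
  have r: "?r \<le> real (Suc j) * d" by (rule grid_mono) simp
  have inc: "\<bar>heat (real k * d - s) \<phi> y - heat (real k * d - ?r) \<phi> y\<bar> \<le> \<gamma> * (C / real m)"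
    if k: "k = Suc (j + m)" "k \<le> n" "1 \<le> m" and \<phi>: "\<phi> \<in> borel_measurable borel" "\<And>y. \<bar>\<phi> y\<bar> \<le> \<gamma>"
    for k m \<phi> \<gamma>
  proof -
    have "0 \<le> \<gamma>" using \<phi>(2)[of 0] by linarith
    have ge: "real m * d \<le> real k * d - s" using s k(1) by (simp add: algebra_simps)
    have m: "0 < real m * d" using k(3) d_pos by simp
    \<comment> \<open>Heat time runs backwards from the grid point: the later evaluation time
      \<open>s\<close> leaves the shorter flow. Even this one lasts at least \<open>m\<close>
      cells.\<close>
    have "\<bar>heat (real k * d - ?r) \<phi> y - heat (real k * d - s) \<phi> y\<bar>
        \<le> \<gamma> * (C * ((real k * d - ?r - (real k * d - s)) / (real k * d - s)))"
      using ge m s grid_mono[OF k(2)] horizon grid_nonneg[of j]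
      by (intro heat_regular \<phi>) linarith+
    also have "(real k * d - ?r - (real k * d - s)) / (real k * d - s) \<le> d / (real m * d)"
      using ge m s d_pos by (intro frac_le) (auto simp: algebra_simps)
    then have "\<gamma> * (C * ((real k * d - ?r - (real k * d - s)) / (real k * d - s))) \<le> \<gamma> * (C * (d / (real m * d)))"
      using \<open>0 \<le> \<gamma>\<close> C_nonneg by (intro mult_left_mono)
    finally show ?thesis using d_pos by (simp add: abs_minus_commute)
  qed
  \<comment> \<open>The error with \<open>m = 0\<close> starts at the end of the present cell, where
    its flow may have length 0. It is bounded by its size alone, twice, whence the 2; the others
    gain from \<open>m\<close> cells.\<close>
  have terms: "\<bar>heat (real (i m) * d - s) (\<epsilon> m) y - heat (real (i m) * d - ?r) (\<epsilon> m) y\<bar>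
      \<le> b * N * (if m = 0 then 2 else C / real m)" if m: "m \<le> p" for m
  proof (cases "m = 0")
    case True
    have "\<bar>heat (real (i m) * d - z) (\<epsilon> m) y\<bar> \<le> b * N" if "z \<le> real (Suc j) * d" for z
      using z_le[OF that, of m] by (intro heat_bounded \<epsilon>_meas[OF m] \<epsilon>_le[OF m]) auto
    from this[OF s(2)] this[OF r] show ?thesis using True by simp
  next
    case False
    then show ?thesis
      using inc[of "i m" m "\<epsilon> m" "b * N"] \<epsilon>_meas[OF m] \<epsilon>_le[OF m] i_le[of m] m
      by (auto simp: i_def)
  qed
  have sum: "(\<Sum>m\<le>q. if m = 0 then 2 else C / real m) = 2 + C * harm q" for q
    by (induction q) (auto simp: harm_Suc harm_expand field_simps)
  have "\<bar>e 0 s - e 0 ?r\<bar> = \<bar>(heat (real n * d - s) f y - heat (real n * d - ?r) f y)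
      + (\<Sum>m\<le>p. heat (real (i m) * d - s) (\<epsilon> m) y - heat (real (i m) * d - ?r) (\<epsilon> m) y)\<bar>"
    unfolding expand[OF s(2)] expand[OF r] by (simp add: sum_subtractf)
  also have "\<dots> \<le> \<bar>heat (real n * d - s) f y - heat (real n * d - ?r) f y\<bar>
      + (\<Sum>m\<le>p. \<bar>heat (real (i m) * d - s) (\<epsilon> m) y - heat (real (i m) * d - ?r) (\<epsilon> m) y\<bar>)"
    by (rule order_trans[OF abs_triangle_ineq add_left_mono[OF sum_abs]])
  also have "\<dots> \<le> N * (C / real (Suc p)) + (\<Sum>m\<le>p. b * N * (if m = 0 then 2 else C / real m))"
  proof (intro add_mono sum_mono)
    have "\<bar>f z\<bar> \<le> N" for z
    proof -
      have "\<beta> * 1 \<le> N" unfolding N_def using \<beta>_nonneg b_nonneg by (intro mult_left_mono) auto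
      then show ?thesis using f_bounded[of z] by linarith
    qed
    then show "\<bar>heat (real n * d - s) f y - heat (real n * d - ?r) f y\<bar> \<le> N * (C / real (Suc p))"
      by (intro inc f_measurable) (auto simp: n)
  qed (use terms in auto)
  also have "\<dots> = N * (C / real (Suc p) + b * (2 + C * harm p))"
    unfolding sum_distrib_left[symmetric] sum by (simp add: algebra_simps)
  also have "Suc p = n - Suc j" by (simp add: n)
  finally show ?thesis
    by (simp add: e_def i_def N_def p_def)
qed

end


subsection \<open>Replacing one cell at a time\<close>

context lattice_approximation
begin

text \<open>Cells before, in and after the \<open>j\<close>-th one add up to \<open>n\<close>. This
  is why every estimate may spend one factor \<open>exp b\<close> per cell.\<close>

lemma exp_grid_split: "j < n \<Longrightarrow> exp (real j * b) * (exp b * exp (real (n - Suc j) * b)) = exp (real n * b)"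
  by (simp add: exp_add[symmetric] of_nat_diff algebra_simps)

lemma exp_grid_split_le: "j < n \<Longrightarrow> exp (real j * b) * exp (real (n - Suc j) * b) \<le> exp (real n * b)"
  using b_nonneg by (simp add: exp_add[symmetric] of_nat_diff algebra_simps)

lemma W_shift_measurable: "0 \<le> q \<Longrightarrow> (\<lambda>\<omega>. x + W q \<omega>) \<in> borel_measurable M"
  by (intro borel_measurable_add W_measurable) auto

lemma W_shift_past: "0 \<le> q \<Longrightarrow> q \<le> v \<Longrightarrow> (\<lambda>\<omega>. x + W q \<omega>) \<in> borel_measurable (past v)"
  by (intro borel_measurable_add W_past) auto

lemma exp_sum_measurable: "exp_sum x j \<in> borel_measurable M"
  by (rule measurable_past_le[OF exp_sum_past[of j "real j * d"]]) (use d_pos in auto)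

text \<open>For the two end cells: before the first there is no past to smooth with, and after the
  last \<open>f\<close> has no further time in which to be smoothed.\<close>

lemma cell_increment_trivial:
  assumes j: "j < n" and q: "0 \<le> q"
  shows "\<bar>expectation (\<lambda>\<omega>. exp_sum x j \<omega> * (h (x + W q \<omega>) - h (x + W (real j * d) \<omega>))
      * tail (Suc j) (x + W (real (Suc j) * d) \<omega>) \<omega>)\<bar> \<le> H * (\<beta> * exp (real n * b)) * 2"
proof (rule expectation_abs_le)
  have S: "Suc j \<le> n" using j by simp
  show "(\<lambda>\<omega>. exp_sum x j \<omega> * (h (x + W q \<omega>) - h (x + W (real j * d) \<omega>))
      * tail (Suc j) (x + W (real (Suc j) * d) \<omega>) \<omega>) \<in> borel_measurable M"
    using q by (intro borel_measurable_times borel_measurable_diff exp_sum_measurable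
        tail_measurable_M[OF S] W_shift_measurable measurable_compose[OF _ h_measurable] grid_nonneg)
  fix \<omega> assume \<omega>: "\<omega> \<in> space M"
  have "\<bar>h (x + W q \<omega>) - h (x + W (real j * d) \<omega>)\<bar> \<le> 2 * H"
    using h_bounded[of "x + W q \<omega>"] h_bounded[of "x + W (real j * d) \<omega>"] by linarith
  then have "\<bar>exp_sum x j \<omega> * (h (x + W q \<omega>) - h (x + W (real j * d) \<omega>))
      * tail (Suc j) (x + W (real (Suc j) * d) \<omega>) \<omega>\<bar>
    \<le> exp (real j * b) * (2 * H) * (\<beta> * exp (real (n - Suc j) * b))"
    unfolding abs_mult using H_nonneg
    by (intro mult_mono exp_sum_bounded tail_bounded[OF S \<omega>]) auto
  also have "\<dots> = 2 * H * \<beta> * (exp (real j * b) * exp (real (n - Suc j) * b))"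
    by simp
  also have "\<dots> \<le> 2 * H * \<beta> * exp (real n * b)"
    using H_nonneg \<beta>_nonneg by (intro mult_left_mono exp_grid_split_le[OF j]) auto
  finally show "\<bar>exp_sum x j \<omega> * (h (x + W q \<omega>) - h (x + W (real j * d) \<omega>))
      * tail (Suc j) (x + W (real (Suc j) * d) \<omega>) \<omega>\<bar> \<le> H * (\<beta> * exp (real n * b)) * 2"
    by (simp add: algebra_simps)
qed

text \<open>The Markov property at the end of the cell averages the future into
  \<open>tail_value (Suc j)\<close>; applied again at the evaluation time it produces a heat flow.
  That time then occurs twice, as the position of the process and as the length of the flow. The
  past takes care of the first, the future of the second.\<close>

lemma cell_increment:
  assumes j: "1 \<le> j" "Suc (Suc j) \<le> n" and q: "real j * d \<le> q" "q \<le> real (Suc j) * d"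
  shows "\<bar>expectation (\<lambda>\<omega>. exp_sum x j \<omega> * (h (x + W q \<omega>) - h (x + W (real j * d) \<omega>))
      * tail (Suc j) (x + W (real (Suc j) * d) \<omega>) \<omega>)\<bar>
    \<le> H * (\<beta> * exp (real n * b)) * ((C / real j + b * C * harm j)
      + (C / real (n - Suc j) + b * (2 + C * harm (n - Suc (Suc j)))))"
    (is "_ \<le> _ * (?KA + ?KB)")
proof -
  let ?r = "real j * d" and ?v = "real (Suc j) * d"
  let ?Y = "\<lambda>q \<omega>. x + W q \<omega>"
  let ?A = "exp_sum x j"
  let ?g = "tail_value (Suc j)"
  define \<gamma> where "\<gamma> = \<beta> * exp (real (n - Suc j) * b)"
  have S: "Suc j \<le> n" using j by simp
  have q0: "0 \<le> q" using q grid_nonneg[of j] by linarith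
  have rv: "?r \<le> ?v" by (rule grid_mono) simp
  have g: "?g \<in> borel_measurable borel" "\<bar>?g y\<bar> \<le> \<gamma>" for y
    using tail_value_measurable[OF S] tail_value_bounded[OF S] by (auto simp: \<gamma>_def)
  have A_past: "?A \<in> borel_measurable (past p)" if "?r \<le> p" for p
    using that d_pos grid_nonneg[of j] by (intro exp_sum_past) linarith+
  have hY_past: "(\<lambda>\<omega>. h (?Y p \<omega>)) \<in> borel_measurable (past p')" if "0 \<le> p" "p \<le> p'" for p p'
    by (rule measurable_compose[OF W_shift_past[OF that] h_measurable])
  have Ah: "\<bar>?A \<omega> * h (?Y p \<omega>)\<bar> \<le> exp (real j * b) * H" for p \<omega>
    unfolding abs_mult by (intro mult_mono exp_sum_bounded h_bounded) auto
  have AhM: "(\<lambda>\<omega>. ?A \<omega> * h (?Y p \<omega>)) \<in> borel_measurable M" if "0 \<le> p" for p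
    by (intro borel_measurable_times exp_sum_measurable measurable_compose[OF W_shift_measurable[OF that] h_measurable])
  have int: "integrable M (\<lambda>\<omega>. ?A \<omega> * h (?Y p \<omega>) * \<phi> (?Y p' \<omega>))"
    if "0 \<le> p" "0 \<le> p'" "\<phi> \<in> borel_measurable borel" "\<And>y. \<bar>\<phi> y\<bar> \<le> \<gamma>" for p p' \<phi>
  proof (rule integrable_bounded)
    show "(\<lambda>\<omega>. ?A \<omega> * h (?Y p \<omega>) * \<phi> (?Y p' \<omega>)) \<in> borel_measurable M"
      by (intro borel_measurable_times[OF AhM[OF that(1)]] measurable_compose[OF W_shift_measurable[OF that(2)] that(3)])
    show "\<bar>?A \<omega> * h (?Y p \<omega>) * \<phi> (?Y p' \<omega>)\<bar> \<le> exp (real j * b) * H * \<gamma>" for \<omega>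
      unfolding abs_mult[of "?A \<omega> * h (?Y p \<omega>)"] using H_nonneg by (intro mult_mono Ah that(4)) auto
  qed
  have hm: "heat (?v - p) ?g \<in> borel_measurable borel" "\<bar>heat (?v - p) ?g y\<bar> \<le> \<gamma>" if "p \<le> ?v" for p y
    using that g by (auto intro: heat_measurable heat_bounded)
  have at: "expectation (\<lambda>\<omega>. ?A \<omega> * h (?Y p \<omega>) * ?g (?Y ?v \<omega>))
      = expectation (\<lambda>\<omega>. ?A \<omega> * h (?Y p \<omega>) * heat (?v - p) ?g (?Y p \<omega>))"
    if p: "?r \<le> p" "p \<le> ?v" for p
  proof -
    have p0: "0 \<le> p" using p grid_nonneg[of j] by linarith
    have "expectation (\<lambda>\<omega>. ?A \<omega> * h (?Y p \<omega>) * ?g (?Y p \<omega> + (W ?v \<omega> - W p \<omega>)))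
        = expectation (\<lambda>\<omega>. ?A \<omega> * h (?Y p \<omega>) * heat (?v - p) ?g (?Y p \<omega>))"
      using p p0 by (intro markov_heat[OF _ _ _ Ah _ g] borel_measurable_times A_past hY_past W_shift_past) auto
    then show ?thesis by simp
  qed
  \<comment> \<open>The length of the flow is fixed at \<open>?v - q\<close>, so one and the same
    function is compared at both times. \<open>smooth_past\<close> needs it only bounded and
    measurable, which is essential as \<open>h\<close> is a factor.\<close>
  define k where "k y = h y * heat (?v - q) ?g y" for y
  have k: "k \<in> borel_measurable borel" "\<bar>k y\<bar> \<le> H * \<gamma>" for y
    unfolding k_def abs_mult using hm[OF q(2)] H_nonneg
    by (auto intro!: borel_measurable_times h_measurable mult_mono h_bounded)
  let ?\<delta> = "\<lambda>y. heat (?v - q) ?g y - heat (?v - ?r) ?g y"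
  have "expectation (\<lambda>\<omega>. ?A \<omega> * (h (?Y q \<omega>) - h (?Y ?r \<omega>)) * tail (Suc j) (?Y ?v \<omega>) \<omega>)
      = expectation (\<lambda>\<omega>. ?A \<omega> * (h (?Y q \<omega>) - h (?Y ?r \<omega>)) * ?g (?Y ?v \<omega>))"
  proof (rule markov_tail[OF S, where c = "exp (real j * b) * (2 * H)"])
    show "(\<lambda>\<omega>. ?A \<omega> * (h (?Y q \<omega>) - h (?Y ?r \<omega>))) \<in> borel_measurable (past ?v)"
      using q q0 rv grid_nonneg by (intro borel_measurable_times borel_measurable_diff A_past hY_past) 
    show "\<bar>?A \<omega> * (h (?Y q \<omega>) - h (?Y ?r \<omega>))\<bar> \<le> exp (real j * b) * (2 * H)" for \<omega>
      using Ah[of \<omega> q] Ah[of \<omega> ?r] unfolding right_diff_distrib by linarith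
  qed (use W_shift_past grid_nonneg in blast)
  also have "\<dots> = expectation (\<lambda>\<omega>. ?A \<omega> * h (?Y q \<omega>) * ?g (?Y ?v \<omega>) - ?A \<omega> * h (?Y ?r \<omega>) * ?g (?Y ?v \<omega>))"
    by (simp add: algebra_simps)
  also have "\<dots> = expectation (\<lambda>\<omega>. ?A \<omega> * h (?Y q \<omega>) * ?g (?Y ?v \<omega>))
      - expectation (\<lambda>\<omega>. ?A \<omega> * h (?Y ?r \<omega>) * ?g (?Y ?v \<omega>))"
    using q0 by (intro Bochner_Integration.integral_diff int g grid_nonneg)
  also have "\<dots> = expectation (\<lambda>\<omega>. ?A \<omega> * h (?Y q \<omega>) * heat (?v - q) ?g (?Y q \<omega>))
      - expectation (\<lambda>\<omega>. ?A \<omega> * h (?Y ?r \<omega>) * heat (?v - ?r) ?g (?Y ?r \<omega>))"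
    using at[OF q] at[OF order_refl rv] by simp
  \<comment> \<open>Inserts the mixed term: position at \<open>?r\<close>, but the flow length that
    belongs to \<open>q\<close>.\<close>
  also have "\<dots> = (expectation (\<lambda>\<omega>. ?A \<omega> * h (?Y q \<omega>) * heat (?v - q) ?g (?Y q \<omega>))
      - expectation (\<lambda>\<omega>. ?A \<omega> * h (?Y ?r \<omega>) * heat (?v - q) ?g (?Y ?r \<omega>)))
      + (expectation (\<lambda>\<omega>. ?A \<omega> * h (?Y ?r \<omega>) * heat (?v - q) ?g (?Y ?r \<omega>))
      - expectation (\<lambda>\<omega>. ?A \<omega> * h (?Y ?r \<omega>) * heat (?v - ?r) ?g (?Y ?r \<omega>)))"
    by simp
  also have "\<dots> = expectation (\<lambda>\<omega>. ?A \<omega> * h (?Y q \<omega>) * heat (?v - q) ?g (?Y q \<omega>)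
        - ?A \<omega> * h (?Y ?r \<omega>) * heat (?v - q) ?g (?Y ?r \<omega>))
      + expectation (\<lambda>\<omega>. ?A \<omega> * h (?Y ?r \<omega>) * heat (?v - q) ?g (?Y ?r \<omega>)
        - ?A \<omega> * h (?Y ?r \<omega>) * heat (?v - ?r) ?g (?Y ?r \<omega>))"
    using q0 by (intro arg_cong2[where f = "(+)"] Bochner_Integration.integral_diff[symmetric] int
        hm q rv grid_nonneg)
  also have "\<dots> = expectation (\<lambda>\<omega>. ?A \<omega> * (k (?Y q \<omega>) - k (?Y ?r \<omega>)))
      + expectation (\<lambda>\<omega>. ?A \<omega> * h (?Y ?r \<omega>) * ?\<delta> (?Y ?r \<omega>))"
    by (simp add: k_def algebra_simps)
  finally have "expectation (\<lambda>\<omega>. ?A \<omega> * (h (?Y q \<omega>) - h (?Y ?r \<omega>)) * tail (Suc j) (?Y ?v \<omega>) \<omega>)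
    = expectation (\<lambda>\<omega>. ?A \<omega> * (k (?Y q \<omega>) - k (?Y ?r \<omega>)))
      + expectation (\<lambda>\<omega>. ?A \<omega> * h (?Y ?r \<omega>) * ?\<delta> (?Y ?r \<omega>))" .
  moreover have "\<bar>expectation (\<lambda>\<omega>. ?A \<omega> * (k (?Y q \<omega>) - k (?Y ?r \<omega>)))\<bar> \<le> exp (real j * b) * (H * \<gamma>) * ?KA"
    using j q by (intro smooth_past k) auto
  moreover have "\<bar>expectation (\<lambda>\<omega>. ?A \<omega> * h (?Y ?r \<omega>) * ?\<delta> (?Y ?r \<omega>))\<bar> \<le> exp (real j * b) * H * (\<gamma> * ?KB)"
  proof (rule expectation_abs_le)
    show "(\<lambda>\<omega>. ?A \<omega> * h (?Y ?r \<omega>) * ?\<delta> (?Y ?r \<omega>)) \<in> borel_measurable M"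
      by (intro borel_measurable_times[OF AhM] borel_measurable_diff grid_nonneg
          measurable_compose[OF W_shift_measurable hm(1)] q rv)
    show "\<bar>?A \<omega> * h (?Y ?r \<omega>) * ?\<delta> (?Y ?r \<omega>)\<bar> \<le> exp (real j * b) * H * (\<gamma> * ?KB)" for \<omega>
      unfolding abs_mult[of "?A \<omega> * h (?Y ?r \<omega>)"] \<gamma>_def using H_nonneg
      by (intro mult_mono Ah smooth_future j q) auto
  qed
  ultimately have "\<bar>expectation (\<lambda>\<omega>. ?A \<omega> * (h (?Y q \<omega>) - h (?Y ?r \<omega>)) * tail (Suc j) (?Y ?v \<omega>) \<omega>)\<bar>
    \<le> exp (real j * b) * (H * \<gamma>) * ?KA + exp (real j * b) * H * (\<gamma> * ?KB)"
    by linarith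
  also have "\<dots> = H * (\<beta> * (exp (real j * b) * exp (real (n - Suc j) * b))) * (?KA + ?KB)"
    unfolding \<gamma>_def by (simp only: algebra_simps)
  also have "\<dots> \<le> H * (\<beta> * exp (real n * b)) * (?KA + ?KB)"
  proof (intro mult_right_mono mult_left_mono exp_grid_split_le H_nonneg \<beta>_nonneg)
    have "0 \<le> (harm k :: real)" for k by (rule harm_nonneg)
    then show "0 \<le> ?KA + ?KB" using b_nonneg C_nonneg
      by (intro add_nonneg_nonneg mult_nonneg_nonneg divide_nonneg_nonneg) auto
  qed (use j in simp)
  finally show ?thesis .
qed

text \<open>The discrete sum drives the first \<open>j\<close> cells, the time integral the remaining ones.\<close>

definition hybrid :: "'a \<Rightarrow> nat \<Rightarrow> real" where
  "hybrid x j = expectation (\<lambda>\<omega>. exp_sum x j \<omega> * tail j (x + W (real j * d) \<omega>) \<omega>)"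

text \<open>Both expectations share the weight before the cell and the tail after it; only
  \<open>exp (u \<omega>)\<close> against \<open>exp (w \<omega>)\<close> differs. To first order
  this is \<open>lam\<close> times the time integral of the increments of \<open>h\<close> within
  the cell, each bounded in expectation through \<open>\<kappa>\<close>. The summand
  \<open>b\<close> is the second-order remainder.\<close>

lemma hybrid_step:
  assumes j: "j < n"
    and \<kappa>: "\<And>q. real j * d < q \<Longrightarrow> q \<le> real (Suc j) * d \<Longrightarrow>
      \<bar>expectation (\<lambda>\<omega>. exp_sum x j \<omega> * (h (x + W q \<omega>) - h (x + W (real j * d) \<omega>))
        * tail (Suc j) (x + W (real (Suc j) * d) \<omega>) \<omega>)\<bar> \<le> H * (\<beta> * exp (real n * b)) * \<kappa>"
  shows "\<bar>hybrid x j - hybrid x (Suc j)\<bar> \<le> b * (\<beta> * exp (real n * b)) * (b + \<kappa>)"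
proof -
  let ?r = "real j * d" and ?v = "real (Suc j) * d" and ?N = "\<beta> * exp (real n * b)"
  let ?Y = "\<lambda>q \<omega>. x + W q \<omega>"
  let ?A = "exp_sum x j"
  let ?\<tau> = "\<lambda>\<omega>. tail (Suc j) (?Y ?v \<omega>) \<omega>"
  define u where "u \<omega> = lam * path_integral ?r ?v (?Y ?r \<omega>) \<omega>" for \<omega>
  define w where "w \<omega> = lam * d * h (?Y ?r \<omega>)" for \<omega>
  \<comment> \<open>\<open>max\<close> leaves the integrand unchanged inside the cell and makes it
    jointly measurable over all real times.\<close>
  define D where "D q \<omega> = ?A \<omega> * (h (?Y (max ?r q) \<omega>) - h (?Y ?r \<omega>)) * ?\<tau> \<omega>" for q \<omega>
  have S: "Suc j \<le> n" using j by simp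
  have rv: "?r \<le> ?v" by (rule grid_mono) simp
  have vr: "?v - ?r = d" by (simp add: distrib_right)
  have \<tau>M: "?\<tau> \<in> borel_measurable M"
    by (intro tail_measurable_M[OF S] W_shift_measurable grid_nonneg)
  have \<tau>_le: "\<bar>?\<tau> \<omega>\<bar> \<le> \<beta> * exp (real (n - Suc j) * b)" if "\<omega> \<in> space M" for \<omega>
    using that by (rule tail_bounded[OF S])
  have hM: "(\<lambda>\<omega>. h (?Y ?r \<omega>)) \<in> borel_measurable M"
    by (rule measurable_compose[OF W_shift_measurable[OF grid_nonneg] h_measurable])
  have idM: "(\<lambda>\<omega>. \<omega>) \<in> measurable M (future ?r)"
    using measurable_future_le[of ?r id "future ?r"] by (simp add: id_def)
  have YM: "?Y ?r \<in> borel_measurable M" by (rule W_shift_measurable[OF grid_nonneg])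
  have uM: "u \<in> borel_measurable M"
  proof -
    have "(\<lambda>\<omega>. (?Y ?r \<omega>, \<omega>)) \<in> measurable M (borel \<Otimes>\<^sub>M future ?r)"
      using YM idM by (rule measurable_Pair)
    from measurable_compose[OF this path_integral_measurable[OF grid_nonneg, of j ?v]]
    show ?thesis unfolding u_def by simp
  qed
  have u_le: "\<bar>u \<omega>\<bar> \<le> b" if "\<omega> \<in> space M" for \<omega>
    unfolding u_def using lam_path_integral_le[of j "Suc j" \<omega> "?Y ?r \<omega>"] that by simp
  have w_le: "\<bar>w \<omega>\<bar> \<le> b" for \<omega>
    unfolding w_def by (rule lam_h_le)
  let ?R = "\<lambda>\<omega>. ?A \<omega> * ((exp (u \<omega>) - exp (w \<omega>)) - (u \<omega> - w \<omega>)) * ?\<tau> \<omega>"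
  have wM: "w \<in> borel_measurable M" unfolding w_def using hM by measurable
  have RM: "?R \<in> borel_measurable M"
    using exp_sum_measurable \<tau>M uM wM by measurable
  have R_le: "\<bar>?R \<omega>\<bar> \<le> b\<^sup>2 * ?N" if "\<omega> \<in> space M" for \<omega>
  proof -
    have "\<bar>?R \<omega>\<bar> \<le> exp (real j * b) * (b\<^sup>2 * exp b) * (\<beta> * exp (real (n - Suc j) * b))"
      unfolding abs_mult[of "?A \<omega>"] abs_mult[of "?A \<omega> * _"] using that
      by (intro mult_mono exp_sum_bounded exp_difference_second_order u_le w_le \<tau>_le) auto
    also have "\<dots> = b\<^sup>2 * (\<beta> * (exp (real j * b) * (exp b * exp (real (n - Suc j) * b))))"
      by simp
    finally show ?thesis unfolding exp_grid_split[OF j] .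
  qed
  have D_cell: "(LBINT q:{?r<..?v}. D q \<omega>) = ?A \<omega> * (path_integral ?r ?v (?Y ?r \<omega>) \<omega> - d * h (?Y ?r \<omega>)) * ?\<tau> \<omega>"
    if \<omega>: "\<omega> \<in> space M" for \<omega>
  proof -
    have si: "set_integrable lborel {?r<..?v} (\<lambda>q. h (?Y ?r \<omega> + (W q \<omega> - W ?r \<omega>)))"
      by (rule potential_set_integrable[OF grid_nonneg \<omega>])
    have sc: "set_integrable lborel {?r<..?v} (\<lambda>q. h (?Y ?r \<omega>))"
      unfolding set_integrable_def using rv by (intro integrable_scaleR_left integrable_real_indicator) auto
    have "(LBINT q:{?r<..?v}. D q \<omega>)
        = (LBINT q:{?r<..?v}. ?A \<omega> * (h (?Y ?r \<omega> + (W q \<omega> - W ?r \<omega>)) - h (?Y ?r \<omega>)) * ?\<tau> \<omega>)"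
      by (rule set_lebesgue_integral_cong) (auto simp: D_def max_def)
    also have "\<dots> = ?A \<omega> * (LBINT q:{?r<..?v}. h (?Y ?r \<omega> + (W q \<omega> - W ?r \<omega>)) - h (?Y ?r \<omega>)) * ?\<tau> \<omega>"
      by (simp add: set_integral_mult_left set_integral_mult_right)
    also have "(LBINT q:{?r<..?v}. h (?Y ?r \<omega> + (W q \<omega> - W ?r \<omega>)) - h (?Y ?r \<omega>))
        = path_integral ?r ?v (?Y ?r \<omega>) \<omega> - (LBINT q:{?r<..?v}. h (?Y ?r \<omega>))"
      unfolding path_integral_def by (rule set_integral_diff(2)[OF si sc])
    also have "(LBINT q:{?r<..?v}. h (?Y ?r \<omega>)) = d * h (?Y ?r \<omega>)"
      using rv vr by (simp add: set_lebesgue_integral_def)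
    finally show ?thesis .
  qed
  have D_meas: "(\<lambda>(q, \<omega>). D q \<omega>) \<in> borel_measurable (lborel \<Otimes>\<^sub>M M)"
  proof -
    have "(\<lambda>p. ((?Y ?r (snd p), snd p), fst p)) \<in> measurable (lborel \<Otimes>\<^sub>M M) ((borel \<Otimes>\<^sub>M future ?r) \<Otimes>\<^sub>M borel)"
      by (intro measurable_Pair measurable_compose[OF measurable_snd YM] measurable_compose[OF measurable_snd idM])
         (simp add: measurable_fst cong: measurable_cong_sets)
    from measurable_compose[OF this potential_jointly_measurable[OF grid_nonneg[of j]]]
    have [measurable]: "(\<lambda>p. h (?Y (max ?r (fst p)) (snd p))) \<in> borel_measurable (lborel \<Otimes>\<^sub>M M)"
      by simp
    note [measurable] = hM \<tau>M exp_sum_measurable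
    show ?thesis unfolding D_def case_prod_unfold by measurable
  qed
  have D_le: "\<bar>D q \<omega>\<bar> \<le> exp (real j * b) * (2 * H) * (\<beta> * exp (real (n - Suc j) * b))"
    if "\<omega> \<in> space M" for q \<omega>
  proof -
    have "\<bar>h (?Y (max ?r q) \<omega>) - h (?Y ?r \<omega>)\<bar> \<le> 2 * H"
      using h_bounded[of "?Y (max ?r q) \<omega>"] h_bounded[of "?Y ?r \<omega>"] by linarith
    then show ?thesis
      unfolding D_def abs_mult using that H_nonneg by (intro mult_mono exp_sum_bounded \<tau>_le) auto
  qed
  let ?L = "\<lambda>\<omega>. LBINT q:{?r<..?v}. D q \<omega>"
  have L_le: "\<bar>expectation ?L\<bar> \<le> (?v - ?r) * (H * ?N * \<kappa>)"
    using \<kappa> by (intro expectation_integral_le[OF D_meas D_le rv]) (auto simp: D_def max_def)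
  have LM: "?L \<in> borel_measurable M"
  proof -
    have "(\<lambda>p. path_integral ?r ?v (fst p) (snd p)) \<in> borel_measurable (borel \<Otimes>\<^sub>M future ?r)"
      using path_integral_measurable[OF grid_nonneg, of j ?v] by (simp add: case_prod_unfold)
    from measurable_compose[OF measurable_Pair[OF YM idM] this]
    have [measurable]: "(\<lambda>\<omega>. path_integral ?r ?v (?Y ?r \<omega>) \<omega>) \<in> borel_measurable M" by simp
    note [measurable] = hM \<tau>M exp_sum_measurable
    have "(\<lambda>\<omega>. ?A \<omega> * (path_integral ?r ?v (?Y ?r \<omega>) \<omega> - d * h (?Y ?r \<omega>)) * ?\<tau> \<omega>) \<in> borel_measurable M"
      by measurable
    then show ?thesis by (rule measurable_cong[THEN iffD2, rotated]) (rule D_cell)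
  qed
  have L_int: "integrable M ?L"
  proof (rule integrable_bounded[OF LM])
    fix \<omega> assume \<omega>: "\<omega> \<in> space M"
    have "\<bar>path_integral ?r ?v (?Y ?r \<omega>) \<omega> - d * h (?Y ?r \<omega>)\<bar> \<le> H * d + d * H"
    proof -
      have "\<bar>path_integral ?r ?v (?Y ?r \<omega>) \<omega>\<bar> \<le> H * d"
        using path_integral_bounded[OF grid_nonneg rv \<omega>, of "?Y ?r \<omega>"] unfolding vr .
      moreover have "\<bar>d * h (?Y ?r \<omega>)\<bar> \<le> d * H"
        unfolding abs_mult using d_pos h_bounded by simp
      ultimately show ?thesis by linarith
    qed
    then show "\<bar>?L \<omega>\<bar> \<le> exp (real j * b) * (H * d + d * H) * (\<beta> * exp (real (n - Suc j) * b))"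
      unfolding D_cell[OF \<omega>] abs_mult[of "?A \<omega>"] abs_mult[of "?A \<omega> * _"] using d_pos H_nonneg \<omega>
      by (intro mult_mono exp_sum_bounded \<tau>_le) auto
  qed
  have R_int: "integrable M ?R" using RM R_le by (rule integrable_bounded)
  have tail_j: "tail j (?Y ?r \<omega>) \<omega> = exp (u \<omega>) * ?\<tau> \<omega>" if "\<omega> \<in> space M" for \<omega>
    unfolding tail_step[OF j that] u_def by simp
  have hyb_int: "integrable M (\<lambda>\<omega>. exp_sum x i \<omega> * tail i (?Y (real i * d) \<omega>) \<omega>)" if i: "i \<le> n" for i
  proof (rule integrable_bounded)
    show "(\<lambda>\<omega>. exp_sum x i \<omega> * tail i (?Y (real i * d) \<omega>) \<omega>) \<in> borel_measurable M"
      by (intro borel_measurable_times exp_sum_measurable tail_measurable_M[OF i] W_shift_measurable grid_nonneg)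
    show "\<bar>exp_sum x i \<omega> * tail i (?Y (real i * d) \<omega>) \<omega>\<bar> \<le> exp (real i * b) * (\<beta> * exp (real (n - i) * b))"
      if "\<omega> \<in> space M" for \<omega>
      unfolding abs_mult by (intro mult_mono exp_sum_bounded tail_bounded[OF i that]) auto
  qed
  have "hybrid x j - hybrid x (Suc j)
      = expectation (\<lambda>\<omega>. ?A \<omega> * tail j (?Y ?r \<omega>) \<omega> - exp_sum x (Suc j) \<omega> * ?\<tau> \<omega>)"
    unfolding hybrid_def using S by (intro Bochner_Integration.integral_diff[symmetric] hyb_int) auto
  also have "\<dots> = expectation (\<lambda>\<omega>. ?R \<omega> + lam * ?L \<omega>)"
  proof (rule Bochner_Integration.integral_cong[OF refl])
    fix \<omega> assume \<omega>: "\<omega> \<in> space M"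
    have "lam * ?L \<omega> = ?A \<omega> * (u \<omega> - w \<omega>) * ?\<tau> \<omega>"
      unfolding D_cell[OF \<omega>] u_def w_def by (simp add: algebra_simps)
    then show "?A \<omega> * tail j (?Y ?r \<omega>) \<omega> - exp_sum x (Suc j) \<omega> * ?\<tau> \<omega> = ?R \<omega> + lam * ?L \<omega>"
      unfolding tail_j[OF \<omega>] exp_sum_Suc w_def[symmetric] by (simp add: algebra_simps)
  qed
  also have "\<dots> = expectation ?R + lam * expectation ?L"
    using R_int L_int by simp
  finally have eq: "hybrid x j - hybrid x (Suc j) = expectation ?R + lam * expectation ?L" .
  have "\<bar>lam * expectation ?L\<bar> \<le> lam * (d * (H * ?N * \<kappa>))"
    unfolding abs_mult using L_le lam_nonneg vr by (simp add: mult_left_mono)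
  also have "\<dots> = b * ?N * \<kappa>" by (simp add: b_def)
  finally have "\<bar>lam * expectation ?L\<bar> \<le> b * ?N * \<kappa>" .
  moreover have "\<bar>expectation ?R\<bar> \<le> b\<^sup>2 * ?N"
    using RM R_le by (rule expectation_abs_le)
  moreover have "b\<^sup>2 * ?N + b * ?N * \<kappa> = b * ?N * (b + \<kappa>)"
    by (simp add: power2_eq_square algebra_simps)
  ultimately show ?thesis unfolding eq by linarith
qed

lemma hybrid_0: "hybrid x 0 = tail_value 0 x"
  by (simp add: hybrid_def tail_value_def W_0)

lemma hybrid_n: "hybrid x n = expectation (\<lambda>\<omega>. exp_sum x n \<omega> * f (x + W (real n * d) \<omega>))"
  by (simp add: hybrid_def tail_def path_integral_def set_lebesgue_integral_def)

text \<open>The prefactor \<open>b\<close> is of order \<open>1 / n\<close>, so the remaining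
  bracket may be of order \<open>ln n\<close>. The terms with an additional \<open>b\<close> are
  summed over up to \<open>n\<close> cells and produce the factor
  \<open>1 + real n * b\<close>.\<close>

lemma hybrid_error:
  assumes n: "2 \<le> n" and C: "1 \<le> C"
  shows "\<bar>hybrid x 0 - hybrid x n\<bar>
    \<le> b * (\<beta> * exp (real n * b)) * (C * (1 + real n * b) * (6 * ln (real n)))"
proof -
  \<comment> \<open>Cells \<open>0\<close> and \<open>Suc m\<close> are the end cells; the
    \<open>m\<close> inner ones are indexed by \<open>Suc i\<close> with
    \<open>i < m\<close>.\<close>
  define m where "m = n - 2"
  have nm: "n = Suc (Suc m)" using n by (simp add: m_def)
  let ?N = "\<beta> * exp (real n * b)" and ?L = "harm m :: real" and ?a = "real n * b"
  have L0: "0 \<le> ?L" by (rule harm_nonneg)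
  have a0: "0 \<le> ?a" using b_nonneg by simp
  have N0: "0 \<le> b * ?N" using b_nonneg \<beta>_nonneg by simp
  \<comment> \<open>The bound of \<open>cell_increment\<close> for the cell \<open>Suc i\<close>,
    with both harmonic numbers enlarged to \<open>harm m\<close>; only the distances to the two ends
    still depend on \<open>i\<close>.\<close>
  define K where "K i = C * (1 / real (Suc i)) + C * (1 / real (m - i)) + b * (2 * C * ?L + 2)" for i
  have ends: "\<bar>hybrid x j - hybrid x (Suc j)\<bar> \<le> b * ?N * (b + 2)" if "j < n" for j
    using that grid_nonneg[of j]
    by (intro hybrid_step cell_increment_trivial) (assumption, assumption, linarith)
  have mid: "\<bar>hybrid x (Suc i) - hybrid x (Suc (Suc i))\<bar> \<le> b * ?N * (b + K i)" if i: "i < m" for i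
  proof (rule order_trans[OF hybrid_step[OF _ cell_increment]])
    have h1: "harm (Suc i) \<le> ?L" "harm (n - Suc (Suc (Suc i))) \<le> ?L"
      using i by (auto intro!: harm_mono simp: nm)
    have "(C / real (Suc i) + b * C * harm (Suc i))
        + (C / real (n - Suc (Suc i)) + b * (2 + C * harm (n - Suc (Suc (Suc i))))) 
      \<le> (C / real (Suc i) + b * C * ?L) + (C / real (n - Suc (Suc i)) + b * (2 + C * ?L))"
      using h1 b_nonneg C by (intro add_mono mult_left_mono order_refl) auto
    also have "\<dots> = K i" by (simp add: K_def nm algebra_simps)
    finally show "b * ?N * (b + ((C / real (Suc i) + b * C * harm (Suc i))
        + (C / real (n - Suc (Suc i)) + b * (2 + C * harm (n - Suc (Suc (Suc i)))))))
      \<le> b * ?N * (b + K i)"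
      using N0 by (intro mult_left_mono) auto
  qed (use i nm in auto)
  have "hybrid x 0 - hybrid x n = (\<Sum>j<n. hybrid x j - hybrid x (Suc j))"
    by (rule sum_lessThan_telescope'[symmetric])
  also have "\<bar>\<dots>\<bar> \<le> (\<Sum>j<n. \<bar>hybrid x j - hybrid x (Suc j)\<bar>)" by (rule sum_abs)
  also have "\<dots> = \<bar>hybrid x 0 - hybrid x (Suc 0)\<bar>
      + (\<Sum>i<m. \<bar>hybrid x (Suc i) - hybrid x (Suc (Suc i))\<bar>)
      + \<bar>hybrid x (Suc m) - hybrid x (Suc (Suc m))\<bar>"
    by (simp add: nm sum.lessThan_Suc_shift[of _ m] sum.lessThan_Suc[of _ "Suc m"] del: sum.lessThan_Suc)
  also have "\<dots> \<le> b * ?N * (b + 2) + (\<Sum>i<m. b * ?N * (b + K i)) + b * ?N * (b + 2)"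
    by (intro add_mono sum_mono ends mid) (auto simp: nm)
  also have "\<dots> = b * ?N * (4 + real n * b + (\<Sum>i<m. K i))"
  proof -
    have "(\<Sum>i<m. b * ?N * (b + K i)) = b * ?N * (real m * b + (\<Sum>i<m. K i))"
      unfolding sum_distrib_left[symmetric] by (simp add: sum.distrib)
    moreover have "real n * b = real m * b + 2 * b" by (simp add: nm algebra_simps)
    ultimately show ?thesis by (simp only: distrib_left distrib_right)
  qed
  also have "(\<Sum>i<m. K i) = 2 * C * ?L + real m * b * (2 * C * ?L + 2)"
  proof -
    have "(\<Sum>i<m. 1 / real (Suc i)) = ?L" by (simp add: harm_altdef inverse_eq_divide)
    then show ?thesis
      unfolding K_def sum.distrib sum_distrib_left[symmetric] sum_inverse_reversed
      by (simp add: algebra_simps)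
  qed
  also have "b * ?N * (4 + real n * b + (2 * C * ?L + real m * b * (2 * C * ?L + 2)))
      \<le> b * ?N * (C * (1 + ?a) * (6 * ln (real n)))"
  proof (rule mult_left_mono[OF _ N0])
    have "real m * b * (2 * C * ?L + 2) \<le> ?a * (2 * C * ?L + 2)"
      using b_nonneg C L0 by (intro mult_right_mono) (auto simp: nm)
    then have "4 + real n * b + (2 * C * ?L + real m * b * (2 * C * ?L + 2))
        \<le> 4 + 3 * ?a + C * (1 + ?a) * (2 * ?L)"
      by (simp add: algebra_simps)
    \<comment> \<open>In \<open>3 * ?a\<close>, one part is the second-order remainder of all cells
      and two come from the trivially bounded \<open>m = 0\<close> errors of
      \<open>smooth_future\<close>. Rounding up to \<open>4 * ?a\<close> lets \<open>1 + ?a\<close>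
      factor out; \<open>1 \<le> C\<close> then gives the common factor \<open>C\<close>.\<close>
    also have "\<dots> \<le> (1 + ?a) * 4 + C * (1 + ?a) * (2 * ?L)"
      using a0 by (simp add: algebra_simps)
    also have "\<dots> \<le> C * (1 + ?a) * 4 + C * (1 + ?a) * (2 * ?L)"
      using C a0 by (intro add_mono mult_right_mono order_refl) auto
    also have "\<dots> = C * (1 + ?a) * (4 + 2 * ?L)" by (simp add: algebra_simps)
    also have "\<dots> \<le> C * (1 + ?a) * (6 * ln (real n))"
      using C a0 harm_le_ln[OF n] by (intro mult_left_mono) (auto simp: m_def)
    finally show "4 + real n * b + (2 * C * ?L + real m * b * (2 * C * ?L + 2))
      \<le> C * (1 + ?a) * (6 * ln (real n))" .
  qed
  finally show ?thesis .
qed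

end


subsection \<open>Brownian motion\<close>

lemma abs_le_sup_norm:
  assumes "bounded (range f)"
  shows "\<bar>f y\<bar> \<le> sup_norm f"
proof -
  obtain a where "\<And>x. \<bar>f x\<bar> \<le> a"
    using assms by (auto simp: bounded_iff)
  then have "bdd_above (range (\<lambda>x. \<bar>f x\<bar>))"
    by (intro bdd_aboveI[of _ a]) auto
  then show ?thesis
    unfolding sup_norm_def by (rule cSUP_upper[rotated]) simp
qed

text \<open>Reconciles the closed interval of the integral functional with left-open cells: a single
  point is a null set.\<close>

lemma set_lebesgue_integral_Icc_Ioc:
  fixes g :: "real \<Rightarrow> real"
  shows "(LBINT q:{a..c}. g q) = (LBINT q:{a<..c}. g q)"
  unfolding set_lebesgue_integral_def
  by (rule integral_discrete_difference[of "{a}"]) (auto simp: indicator_def)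

context brownian_motion
begin

abbreviation centred :: "real \<Rightarrow> 'w \<Rightarrow> 'a" where
  "centred q \<omega> \<equiv> X q \<omega> - X 0 \<omega>"

text \<open>\<open>X 0\<close> cancels in all increments, so their properties carry over.
  Subtracting the random variable \<open>X 0\<close>, and not the point \<open>x\<close>, makes the
  value at time 0 vanish everywhere instead of almost surely.\<close>

lemma levy_process_centred: "levy_process (P x) centred"
proof -
  interpret prob_space "P x" by (rule prob_space_P)
  note D = gaussian_increments[of _ _ x]
  show ?thesis
  proof
    fix s t :: real assume st: "0 \<le> s" "s \<le> t"
    show "distr (P x) borel (\<lambda>\<omega>. centred t \<omega> - centred s \<omega>) = distr (P x) borel (centred (t - s))"
    \<comment> \<open>For equal times the increment is constantly zero and has no Lebesgue density,
      so the Gaussian law is used for \<open>s < t\<close> only.\<close>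
    proof (cases "s = t")
      case False
      have "distr (P x) lborel (\<lambda>\<omega>. X t \<omega> - X s \<omega>) = distr (P x) lborel (\<lambda>\<omega>. X (t - s) \<omega> - X 0 \<omega>)"
        using distributed_distr_eq_density[OF D[of s t]] distributed_distr_eq_density[OF D[of 0 "t - s"]]
          st False by simp
      moreover have "distr (P x) lborel U = distr (P x) borel U" for U :: "'w \<Rightarrow> 'a"
        by (rule distr_cong) auto
      ultimately show ?thesis by simp
    qed simp
  next
    fix \<omega> assume "\<omega> \<in> space (P x)"
    then show "continuous_on {0..} (\<lambda>q. centred q \<omega>)"
      by (intro continuous_on_diff continuous_paths continuous_on_const)
  next
    fix k and \<tau> :: "nat \<Rightarrow> real"
    assume "0 \<le> \<tau> 0" "\<And>i. i < k \<Longrightarrow> \<tau> i \<le> \<tau> (Suc i)"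
    then show "indep_vars (\<lambda>_. borel) (\<lambda>i \<omega>. centred (\<tau> (Suc i)) \<omega> - centred (\<tau> i) \<omega>) {..<k}"
      using independent_increments[of \<tau> k x] by simp
  qed (auto intro!: borel_measurable_diff measurable_X)
qed

text \<open>The starting point is moved into the test function \<open>\<phi> (y + z)\<close>, whose
  bound does not depend on \<open>y\<close>; the kernel estimate at 0 thus holds uniformly in
  \<open>y\<close>.\<close>

lemma heat_regular_centred:
  fixes x :: 'a
  assumes rs: "0 < r" "r \<le> s" "s \<le> T" and c1: "0 \<le> c1" and C: "0 \<le> C"
    and prob: "\<And>q. 0 < q \<Longrightarrow>
      prob_space (density lborel (\<lambda>y::'a. ennreal (gauss_kernel c1 c2 q 0 y)))"
    and deriv: "\<And>q y :: 'a. 0 < q \<Longrightarrow> q \<le> T \<Longrightarrow>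
      \<bar>deriv (\<lambda>u. transition_density u 0 y) q\<bar> \<le> C * (1 / q) * gauss_kernel c1 c2 q 0 y"
    and \<phi>: "\<phi> \<in> borel_measurable borel" "\<And>y. \<bar>\<phi> y\<bar> \<le> \<gamma>"
  shows "\<bar>levy_process.heat (P x) centred s \<phi> y - levy_process.heat (P x) centred r \<phi> y\<bar>
    \<le> \<gamma> * (C * ((s - r) / r))"
proof -
  interpret levy_process "P x" centred by (rule levy_process_centred)
  have "(\<lambda>z. \<phi> (y + z)) \<in> borel_measurable borel"
    using \<phi>(1) by measurable
  then show ?thesis
    unfolding heat_def
    using rs C \<phi>(2) gaussian_increments[of 0 s x] gaussian_increments[of 0 r x]
      transition_density_L1_diff[OF rs c1 C prob deriv]
    by (intro expectation_diff_density[where p = "transition_density s 0" and q = "transition_density r 0"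
          and \<phi> = "\<lambda>z. \<phi> (y + z)"]) (auto intro: transition_density_nonneg)
qed

end

text \<open>For fixed \<open>x\<close> the general estimate is applied to \<open>X - X 0\<close>
  under \<open>P x\<close>. It yields the bound with \<open>t\<close> in place of \<open>T\<close>,
  and monotonicity gives the stated constant.\<close>

theorem corollary2:
  fixes P :: "'a::euclidean_space \<Rightarrow> 'w measure"
    and X :: "real \<Rightarrow> 'w \<Rightarrow> 'a"
    and f h :: "'a \<Rightarrow> real"
    and T C c1 c2 lam t :: real
    and n :: nat
    and x :: 'a
  assumes "brownian_motion P X"
    and "1 \<le> C"
    and "0 < c1" and "0 < c2"
    and "\<And>s z. 0 < s \<Longrightarrow>
           prob_space (density lborel (\<lambda>y::'a. ennreal (gauss_kernel c1 c2 s z y)))"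
    and "\<And>s (z::'a) y. 0 < s \<Longrightarrow> s \<le> T \<Longrightarrow>
           \<bar>deriv (\<lambda>u. transition_density u z y) s\<bar> \<le> C * (1 / s) * gauss_kernel c1 c2 s z y"
    and "f \<in> borel_measurable borel" and "bounded (range f)"
    and "h \<in> borel_measurable borel" and "bounded (range h)"
    and "0 < lam"
    and "0 \<le> t" and "t \<le> T"
    and "2 \<le> n"
  shows "\<bar>feynman_kac P X lam h t f x - feynman_kac_approx P X lam h t n f x\<bar>
    \<le> 6 * C * lam * sup_norm h * T * (1 + lam * sup_norm h * T) * exp (lam * sup_norm h * T)
        * (ln (real n) / real n) * sup_norm f"
proof -
  interpret brownian_motion P X by fact
  let ?H = "sup_norm h" and ?\<beta> = "sup_norm f"
  have H0: "0 \<le> ?H" and \<beta>0: "0 \<le> ?\<beta>"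
    using abs_le_sup_norm[OF assms(10)] abs_le_sup_norm[OF assms(8)] abs_ge_zero order_trans by blast+
  have T0: "0 \<le> T" using assms(12,13) by linarith
  have ln0: "0 \<le> ln (real n)" using assms(14) by simp
  show ?thesis
  \<comment> \<open>With \<open>t = 0\<close> the mesh would be 0, against \<open>d_pos\<close>;
    both functionals vanish.\<close>
  proof (cases "t = 0")
    case True
    have "integral_functional X 0 h = (\<lambda>_. 0)"
      unfolding integral_functional_def set_lebesgue_integral_Icc_Ioc
      by (simp add: set_lebesgue_integral_def fun_eq_iff)
    moreover have "integral_sum X 0 n h = (\<lambda>_. 0)"
      by (simp add: integral_sum_def fun_eq_iff)
    ultimately have "feynman_kac P X lam h t f x = feynman_kac_approx P X lam h t n f x"
      unfolding feynman_kac_def feynman_kac_approx_def True by simp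
    then show ?thesis
      using H0 \<beta>0 T0 ln0 assms(2,11) by simp
  next
    case False
    define d where "d = t / real n"
    have nd: "real n * d = t" using assms(14) by (simp add: d_def)
    interpret L: lattice_approximation "P x" centred h ?H f ?\<beta> lam C T d n
    proof (intro lattice_approximation.intro potential_process.intro levy_process_centred
        potential_process_axioms.intro lattice_approximation_axioms.intro)
      show "\<bar>levy_process.heat (P x) centred s \<phi> y - levy_process.heat (P x) centred r \<phi> y\<bar>
          \<le> \<gamma> * (C * ((s - r) / r))"
        if "0 < r" "r \<le> s" "s \<le> T" "\<phi> \<in> borel_measurable borel" "\<And>y. \<bar>\<phi> y\<bar> \<le> \<gamma>" for r s \<phi> \<gamma> y
        using assms(2,3) that by (intro heat_regular_centred[OF _ _ _ _ _ assms(5,6)]) auto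
    qed (use assms False abs_le_sup_norm[OF assms(10)] abs_le_sup_norm[OF assms(8)] nd in
        \<open>auto simp: d_def\<close>)
    have X0: "X 0 \<in> borel_measurable (P x)" by (rule measurable_X) simp
    have Xt: "X t \<in> borel_measurable (P x)" using assms(12) by (rule measurable_X)
    \<comment> \<open>Started at the random point \<open>X 0 \<omega>\<close>, the tail reproduces
      the functional at every sample point. The almost sure initial condition is used only
      afterwards, when that point is replaced by \<open>x\<close>.\<close>
    have "feynman_kac P X lam h t f x = L.expectation (\<lambda>\<omega>. L.tail 0 (X 0 \<omega>) \<omega>)"
      unfolding feynman_kac_def
      by (intro Bochner_Integration.integral_cong)
         (simp_all add: L.tail_def L.path_integral_def integral_functional_def
           set_lebesgue_integral_Icc_Ioc nd mult.commute[of "exp _" "f _"])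
    also have "\<dots> = L.expectation (\<lambda>\<omega>. L.tail 0 x \<omega>)"
    proof (rule integral_cong_AE)
      show "AE \<omega> in P x. L.tail 0 (X 0 \<omega>) \<omega> = L.tail 0 x \<omega>"
        using start[of x] by eventually_elim simp
    qed (use L.tail_measurable_M[OF _ X0, of 0] L.tail_measurable_M[of 0 "\<lambda>_. x"] in auto)
    also have "\<dots> = L.hybrid x 0"
      unfolding L.hybrid_0 L.tail_value_def ..
    finally have cont: "feynman_kac P X lam h t f x = L.hybrid x 0" .
    have hX: "(\<lambda>\<omega>. h (X (real j * t / real n) \<omega>)) \<in> borel_measurable (P x)" for j
      using assms(12) by (intro measurable_compose[OF measurable_X assms(9)]) simp
    have "feynman_kac_approx P X lam h t n f x
        = L.expectation (\<lambda>\<omega>. L.exp_sum x n \<omega> * f (x + centred (real n * d) \<omega>))"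
      unfolding feynman_kac_approx_def
    proof (rule integral_cong_AE)
      note [measurable] = hX measurable_compose[OF Xt assms(7)]
      show "(\<lambda>\<omega>. f (X t \<omega>) * exp (lam * integral_sum X t n h \<omega>)) \<in> borel_measurable (P x)"
        unfolding integral_sum_def by measurable
      show "(\<lambda>\<omega>. L.exp_sum x n \<omega> * f (x + centred (real n * d) \<omega>)) \<in> borel_measurable (P x)"
        by (intro borel_measurable_times L.exp_sum_measurable
            measurable_compose[OF L.W_shift_measurable[OF L.grid_nonneg] assms(7)])
      have "integral_sum X t n h \<omega> = d * (\<Sum>j<n. h (X (real j * d) \<omega>))" for \<omega>
        by (simp add: integral_sum_def d_def)
      then show "AE \<omega> in P x. f (X t \<omega>) * exp (lam * integral_sum X t n h \<omega>)
          = L.exp_sum x n \<omega> * f (x + centred (real n * d) \<omega>)"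
        using start[of x]
        by (auto elim!: eventually_mono simp: nd L.exp_sum_def mult.assoc)
    qed
    also have "\<dots> = L.hybrid x n" by (rule L.hybrid_n[symmetric])
    finally have disc: "feynman_kac_approx P X lam h t n f x = L.hybrid x n" .
    have nb: "real n * L.b = lam * ?H * t" "L.b = lam * ?H * t / real n"
      unfolding L.b_def nd[symmetric] using assms(14) by simp_all
    have at: "lam * ?H * t \<le> lam * ?H * T" "0 \<le> lam * ?H * t"
      using assms(11,12,13) H0 by (auto intro!: mult_left_mono)
    have "\<bar>L.hybrid x 0 - L.hybrid x n\<bar>
        \<le> L.b * (?\<beta> * exp (real n * L.b)) * (C * (1 + real n * L.b) * (6 * ln (real n)))"
      by (rule L.hybrid_error[OF assms(14,2)])
    also have "\<dots> = (lam * ?H * t) * exp (lam * ?H * t) * (1 + lam * ?H * t)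
        * (6 * C * (ln (real n) / real n) * ?\<beta>)"
      unfolding nb(1) unfolding nb(2) by simp
    also have "\<dots> \<le> (lam * ?H * T) * exp (lam * ?H * T) * (1 + lam * ?H * T)
        * (6 * C * (ln (real n) / real n) * ?\<beta>)"
      using at ln0 \<beta>0 H0 assms(2,11,12,13) by (intro mult_mono mult_right_mono) auto
    also have "\<dots> = 6 * C * lam * ?H * T * (1 + lam * ?H * T) * exp (lam * ?H * T)
        * (ln (real n) / real n) * ?\<beta>"
      by (simp only: ac_simps)
    finally show ?thesis unfolding cont disc .
  qed
qed

end
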